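(* Let $0<x<1$ and let $\omega^*\langle 1,1,x\rangle$ be a real number for which there exist an integer $n_0\ge 2$ and a bilinear noncommutative algorithm multiplying an $n_0\times\lceil n_0^x\rceil$ matrix by an $\lceil n_0^x\rceil\times n_0$ matrix using at most $n_0^{\omega^*\langle 1,1,x\rangle}$ multiplications. For an $n \times \lceil n^x\rceil$ matrix $A$, an $\lceil n^x \rceil \times n$ matrix $B$ and $\epsilon \geq 0$, there exists a MapReduce algorithm computing $A \times B$ with $O(n^{\omega^*\langle 1, 1, x\rangle(2-\epsilon)/2})$ machines and $O(n^\epsilon)$ memory on each machine, running in $O(\log n)$ rounds.
   Context: A bilinear noncommutative algorithm for multiplying matrices with $l$ multiplications consists of $l$ products $M_i=\alpha_i\beta_i$, where each $\alpha_i$ (resp. $\beta_i$) is a fixed linear combination of entries of the first (resp. second) matrix, such that every entry of the product is a fixed linear combination of the $M_i$, valid also when entries are noncommuting (e.g. matrix blocks). The paper uses the value $\omega^*\langle 1,1,x\rangle = 2$ if $x\le\gamma$ and $\omega^*\langle 1,1,x\rangle = 2+(\omega^*-2)(x-\gamma)/(1-\gamma)\approx 1.83+0.53x$ otherwise, where $\gamma=0.30298$ and $\omega^*\approx 2.3728$ (bounds of Le Gall). MapReduce model: computation proceeds in synchronous rounds; in each round every machine performs arbitrary local computation on its local memory and then machines exchange data (each machine sends/receives at most its memory); the input is initially distributed among machines; memory counts words stored per machine.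
   Formalization: The machine bound is read as O(max(1, n^{ω*(2-ε)/2})): for ε > 2 the exponent is negative and the stated bound would force zero machines for large n, which is impossible; for ε ≤ 2 it equals the stated bound since ω* ≥ 2. *)

theory Defs
  imports "Jordan_Normal_Form.Matrix" "HOL-Library.Landau_Symbols"
begin

section \<open>Bilinear noncommutative algorithms\<close>

text \<open>The linear combination of the \<open>d \<times> d\<close> blocks \<open>X i\<close>, \<open>i \<in> I\<close>, with scalar coefficients \<open>c i\<close>.\<close>

definition block_comb :: "nat \<Rightarrow> 'i set \<Rightarrow> ('i \<Rightarrow> 'a) \<Rightarrow> ('i \<Rightarrow> 'a mat) \<Rightarrow> 'a::field mat" where
  "block_comb d I c X = mat d d (\<lambda>st. \<Sum>i\<in>I. c i * X i $$ st)"

text \<open>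
  Multiplication of an \<open>n \<times> m\<close> matrix \<open>X\<close> by an \<open>m \<times> k\<close> matrix \<open>Y\<close> with the \<open>l\<close> products
  \<open>M i = (\<Sum>\<^sub>p\<^sub>q \<alpha> i (p,q) X (p,q)) (\<Sum>\<^sub>q\<^sub>r \<beta> i (q,r) Y (q,r))\<close>; entry \<open>(p,r)\<close> of the result is
  \<open>\<Sum>\<^sub>i \<gamma> (p,r) i M i\<close>. The coefficients are scalars, whereas the entries are noncommuting: they range
  over the square matrices of every size \<open>d\<close> (\<open>d = 1\<close> being the case of scalar entries).
\<close>

definition nc_bilinear_algorithm ::
  "nat \<Rightarrow> nat \<Rightarrow> nat \<Rightarrow> nat \<Rightarrow> (nat \<Rightarrow> nat \<times> nat \<Rightarrow> 'a) \<Rightarrow> (nat \<Rightarrow> nat \<times> nat \<Rightarrow> 'a)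
    \<Rightarrow> (nat \<times> nat \<Rightarrow> nat \<Rightarrow> 'a::field) \<Rightarrow> bool" where
  "nc_bilinear_algorithm n m k l \<alpha> \<beta> \<gamma> \<longleftrightarrow>
    (\<forall>d X Y.
      (\<forall>p<n. \<forall>q<m. X (p, q) \<in> carrier_mat d d) \<longrightarrow>
      (\<forall>q<m. \<forall>r<k. Y (q, r) \<in> carrier_mat d d) \<longrightarrow>
      (let M = (\<lambda>i. block_comb d ({..<n} \<times> {..<m}) (\<alpha> i) X
                    * block_comb d ({..<m} \<times> {..<k}) (\<beta> i) Y)
       in \<forall>p<n. \<forall>r<k.
            block_comb d {..<l} (\<gamma> (p, r)) M
            = block_comb d {..<m} (\<lambda>_. 1) (\<lambda>q. X (p, q) * Y (q, r))))"


section \<open>The MapReduce model\<close>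

text \<open>
  Machines store key-value pairs. The key consists of three integers, which will be bounded by
  a polynomial in \<open>n\<close>, and the value is one field element; hence a pair is a constant number of words,
  and memory is counted in pairs.
\<close>

type_synonym key = "nat \<times> nat \<times> nat"
type_synonym 'a memory = "(key \<times> 'a) list"

fun key_below :: "nat \<Rightarrow> key \<Rightarrow> bool" where
  "key_below b (u, v, w) \<longleftrightarrow> u < b \<and> v < b \<and> w < b"

datatype 'a expr =
    Const 'a
  | Cell nat
  | Plus "'a expr" "'a expr"
  | Minus "'a expr" "'a expr"
  | Times "'a expr" "'a expr"
  | Divide "'a expr" "'a expr"

primrec expr_val :: "'a::field list \<Rightarrow> 'a expr \<Rightarrow> 'a" where
  "expr_val vs (Const c) = c"
| "expr_val vs (Cell i) = (if i < length vs then vs ! i else 0)"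
| "expr_val vs (Plus e f) = expr_val vs e + expr_val vs f"
| "expr_val vs (Minus e f) = expr_val vs e - expr_val vs f"
| "expr_val vs (Times e f) = expr_val vs e * expr_val vs f"
| "expr_val vs (Divide e f) = expr_val vs e / expr_val vs f"

text \<open>
  A local computation maps the memory of a machine to the list of pairs that it sends to each
  machine \<open>j\<close>. It is arbitrary in the keys. In the values it is a finite case distinction, with
  arbitrary conditions and of arbitrary size, between arithmetic computations \<open>P \<in> S\<close>. Over a finite
  field this allows every function of the values. Over an infinite field, unrestricted functions would
  make the word count meaningless, because a bijection between \<open>'a\<close> and \<open>'a \<times> 'a\<close> could pack an
  entire matrix into a single word.
\<close>

definition local_computation :: "('a::field memory \<Rightarrow> nat \<Rightarrow> 'a memory) \<Rightarrow> bool" where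
  "local_computation f \<longleftrightarrow>
    (\<forall>ks. \<exists>S. finite S \<and>
      (\<forall>vs. length vs = length ks \<longrightarrow>
        (\<exists>P\<in>S. \<forall>j. f (zip ks vs) j = map (\<lambda>(k, e). (k, expr_val vs e)) (P j))))"

text \<open>\<open>\<pi> t i\<close> is the local computation of machine \<open>i\<close> in round \<open>t\<close>.\<close>

type_synonym 'a program = "nat \<Rightarrow> nat \<Rightarrow> 'a memory \<Rightarrow> nat \<Rightarrow> 'a memory"

text \<open>
  After a round, machine \<open>j\<close> stores what the \<open>p\<close> machines sent to it. The data that a machine keeps
  are those it sends to itself.
\<close>

primrec mr_run :: "nat \<Rightarrow> 'a program \<Rightarrow> (nat \<Rightarrow> 'a memory) \<Rightarrow> nat \<Rightarrow> nat \<Rightarrow> 'a memory" where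
  "mr_run p \<pi> M 0 = M"
| "mr_run p \<pi> M (Suc t) = (\<lambda>j. concat (map (\<lambda>i. \<pi> t i (mr_run p \<pi> M t i) j) [0..<p]))"

text \<open>Every pair of \<open>D\<close> is stored exactly once on exactly one of the \<open>p\<close> machines.\<close>

definition distributed_among :: "nat \<Rightarrow> (nat \<Rightarrow> 'a memory) \<Rightarrow> (key \<times> 'a) set \<Rightarrow> bool" where
  "distributed_among p M D \<longleftrightarrow>
    distinct (concat (map M [0..<p])) \<and> set (concat (map M [0..<p])) = D"

text \<open>
  With \<open>p\<close> machines of memory \<open>s\<close> and keys below \<open>b\<close>, the program turns every initial distribution of
  the input \<open>D\<close> into a distribution of the output \<open>E\<close> within \<open>T\<close> rounds. The condition
  \<open>card D \<le> p * s\<close> states that the input fits into the machines, so that an initial distribution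
  exists.
\<close>

definition mr_computes ::
  "nat \<Rightarrow> nat \<Rightarrow> nat \<Rightarrow> nat \<Rightarrow> 'a program \<Rightarrow> (key \<times> 'a) set \<Rightarrow> (key \<times> 'a) set \<Rightarrow> bool" where
  "mr_computes p s b T \<pi> D E \<longleftrightarrow>
    card D \<le> p * s \<and>
    (\<forall>M. distributed_among p M D \<and> (\<forall>i<p. length (M i) \<le> s) \<longrightarrow>
      (\<forall>t\<le>T. \<forall>i<p. length (mr_run p \<pi> M t i) \<le> s \<and>
                    (\<forall>(k, v)\<in>set (mr_run p \<pi> M t i). key_below b k)) \<and>
      (\<forall>t<T. \<forall>i<p. (\<Sum>j<p. length (\<pi> t i (mr_run p \<pi> M t i) j)) \<le> s) \<and>
      distributed_among p (mr_run p \<pi> M T) E)"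

text \<open>The entries of a matrix, labelled by the number \<open>u\<close> of the matrix and by their position.\<close>

definition mat_pairs :: "nat \<Rightarrow> 'a mat \<Rightarrow> (key \<times> 'a) set" where
  "mat_pairs u A = {((u, i, j), A $$ (i, j)) | i j. i < dim_row A \<and> j < dim_col A}"

definition inner_dim :: "real \<Rightarrow> nat \<Rightarrow> nat" where
  "inner_dim x n = nat \<lceil>real n powr x\<rceil>"

text \<open>
  A family of programs, one for each \<open>n\<close>, that multiplies an \<open>n \<times> inner_dim x n\<close> matrix by an
  \<open>inner_dim x n \<times> n\<close> matrix. The numbers of machines, pairs per machine and rounds are \<open>p n\<close>,
  \<open>s n\<close> and \<open>T n\<close>. Since \<open>p n \<ge> 1\<close> is forced by the input being nonempty, a bound
  \<open>O(n\<^sup>e)\<close> on \<open>p n\<close> can only be meant as \<open>O(max 1 (n\<^sup>e))\<close>; the two coincide for \<open>e \<ge> 0\<close>.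
\<close>

definition mr_matrix_mult ::
  "real \<Rightarrow> (nat \<Rightarrow> nat) \<Rightarrow> (nat \<Rightarrow> nat) \<Rightarrow> (nat \<Rightarrow> nat) \<Rightarrow> (nat \<Rightarrow> 'a::field program) \<Rightarrow> bool" where
  "mr_matrix_mult x p s T \<pi> \<longleftrightarrow>
    (\<forall>n t i. local_computation (\<pi> n t i)) \<and>
    (\<exists>b c. (\<lambda>n. real (b n)) \<in> O(\<lambda>n. real n ^ c) \<and>
      (\<forall>n\<ge>1. \<forall>A \<in> carrier_mat n (inner_dim x n). \<forall>B \<in> carrier_mat (inner_dim x n) n.
        mr_computes (p n) (s n) (b n) (T n) (\<pi> n)
          (mat_pairs 0 A \<union> mat_pairs 1 B) (mat_pairs 2 (A * B))))"

end

theory Submission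
  imports Defs "Jordan_Normal_Form.Determinant" "HOL-Library.FuncSet"
begin

text \<open>
  Recurse \<open>L = \<lceil>(1 - \<epsilon>/2) log n / log n\<^sub>0\<rceil>\<close> times, that is, down to \<open>d \<times> d\<close> blocks with
  \<open>d = \<lceil>n / n\<^sub>0\<^sup>L\<rceil> = O(n\<^sup>\<epsilon>\<^sup>/\<^sup>2)\<close>, which fit into one machine. The \<open>l\<^sup>L\<close> machines are the words of length
  \<open>L\<close> over \<open>{..<l}\<close>. By linear independence \<open>n\<^sub>0\<^sup>2 \<le> l\<close>, so a block position of either factor or of the
  product, being \<open>L\<close> pairs of base-\<open>n\<^sub>0\<close> digits, is also such a word, and every machine stores at most
  one block of each matrix at all times. One level of the recursion applies \<open>\<alpha>\<close> and \<open>\<beta>\<close> (or \<open>\<gamma>\<close>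
  on the way back) to one letter of the word, for which machines that differ only in this letter
  exchange their blocks: this is one round with a blow-up by the constant \<open>l\<close>. The correctness is the
  statement that the \<open>L\<close>-th tensor power of the Brent equations holds.
\<close>

section \<open>Bilinear algorithms and their tensor powers\<close>

text \<open>Feeding the algorithm matrix units with scalar entries isolates one coefficient of the
  trilinear identity; these are the Brent equations.\<close>

lemma nc_bilinear_algorithm_brent:
  fixes \<alpha> \<beta> :: "nat \<Rightarrow> nat \<times> nat \<Rightarrow> 'a::field"
  assumes alg: "nc_bilinear_algorithm n m k l \<alpha> \<beta> \<gamma>"
    and "p < n" "r < k" and e: "p' < n" "q' < m" and f: "q'' < m" "r' < k"
  shows "(\<Sum>i<l. \<gamma> (p, r) i * \<alpha> i (p', q') * \<beta> i (q'', r'))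
    = (if p' = p \<and> q' = q'' \<and> r' = r then 1 else 0)"
proof -
  define X :: "nat \<times> nat \<Rightarrow> 'a mat" where "X = (\<lambda>z. mat 1 1 (\<lambda>_. if z = (p', q') then 1 else 0))"
  define Y :: "nat \<times> nat \<Rightarrow> 'a mat" where "Y = (\<lambda>z. mat 1 1 (\<lambda>_. if z = (q'', r') then 1 else 0))"
  define M where "M = (\<lambda>i. block_comb 1 ({..<n} \<times> {..<m}) (\<alpha> i) X
                    * block_comb 1 ({..<m} \<times> {..<k}) (\<beta> i) Y)"
  have "block_comb 1 {..<l} (\<gamma> (p, r)) M
            = block_comb 1 {..<m} (\<lambda>_. 1) (\<lambda>q. X (p, q) * Y (q, r))"
    using alg assms(2,3) unfolding nc_bilinear_algorithm_def Let_def M_def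
    by (auto simp: X_def Y_def)
  from arg_cong[OF this, of "\<lambda>A. A $$ (0, 0)"]
  have eq: "(\<Sum>i<l. \<gamma> (p, r) i * M i $$ (0, 0)) = (\<Sum>q<m. (X (p, q) * Y (q, r)) $$ (0, 0))"
    by (simp add: block_comb_def)
  have M: "M i $$ (0, 0) = \<alpha> i (p', q') * \<beta> i (q'', r')" for i
  proof -
    have "M i $$ (0, 0) = (\<Sum>z\<in>{..<n} \<times> {..<m}. \<alpha> i z * (if z = (p', q') then 1 else 0))
       * (\<Sum>z\<in>{..<m} \<times> {..<k}. \<beta> i z * (if z = (q'', r') then 1 else 0))"
      by (simp add: M_def block_comb_def scalar_prod_def X_def Y_def)
    also have "\<dots> = \<alpha> i (p', q') * \<beta> i (q'', r')"
      using e f by (simp add: if_distrib[of "(*) _"] sum.delta cong: if_cong)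
    finally show ?thesis .
  qed
  have "(X (p, q) * Y (q, r)) $$ (0, 0) = (if q = q' then if p' = p \<and> q' = q'' \<and> r' = r then 1 else 0 else 0)" for q
    by (auto simp: X_def Y_def scalar_prod_def)
  then show ?thesis using eq e by (simp add: M sum.delta mult.assoc)
qed

text \<open>The Brent equations factor the identity of size \<open>n * k\<close> through a space of dimension \<open>l\<close>.\<close>

lemma nc_bilinear_algorithm_rank:
  fixes \<alpha> \<beta> :: "nat \<Rightarrow> nat \<times> nat \<Rightarrow> 'a::field"
  assumes alg: "nc_bilinear_algorithm n m k l \<alpha> \<beta> \<gamma>" and "m > 0"
  shows "n * k \<le> l"
proof (rule ccontr)
  assume "\<not> n * k \<le> l"
  then have l: "l < n * k" by simp
  define N where "N = n * k"
  \<comment> \<open>Both factors are padded with zeros to size \<open>N\<close>, so that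
    determinants exist. The index \<open>e\<close> codes the pair \<open>(e div k, e mod k)\<close>,
    and both inner indices are fixed to \<open>0\<close>, which is legal as
    \<open>m > 0\<close>.\<close>
  define G where "G = mat N N (\<lambda>(e, i). if i < l then \<gamma> (e div k, e mod k) i else 0)"
  define H where "H = mat N N (\<lambda>(i, e). if i < l then \<alpha> i (e div k, 0) * \<beta> i (0, e mod k) else 0)"
  have carrier: "G \<in> carrier_mat N N" "H \<in> carrier_mat N N"
    by (auto simp: G_def H_def)
  have k: "k > 0" using l by (cases k) auto
  have dec: "e div k < n" "e mod k < k" if "e < N" for e
    using that k by (auto simp: N_def less_mult_imp_div_less)
  have "G * H = 1\<^sub>m N"
  proof (rule eq_matI)
    fix e f assume "e < dim_row (1\<^sub>m N :: 'a mat)" "f < dim_col (1\<^sub>m N :: 'a mat)"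
    then have ef: "e < N" "f < N" by auto
    have "(G * H) $$ (e, f) = (\<Sum>i<N. if i < l then \<gamma> (e div k, e mod k) i * (\<alpha> i (f div k, 0) * \<beta> i (0, f mod k)) else 0)"
      using ef by (auto simp: G_def H_def scalar_prod_def lessThan_atLeast0 intro!: sum.cong)
    also have "\<dots> = (\<Sum>i<l. \<gamma> (e div k, e mod k) i * \<alpha> i (f div k, 0) * \<beta> i (0, f mod k))"
      using l by (intro sum.mono_neutral_cong_right) (auto simp: N_def mult.assoc)
    also have "\<dots> = (if f div k = e div k \<and> f mod k = e mod k then 1 else 0)"
      using nc_bilinear_algorithm_brent[OF alg dec[OF ef(1)] _ _ _ dec(2)[OF ef(2)]]
        dec(1)[OF ef(2)] assms(2) by simp
    also have "\<dots> = (if e = f then 1 else 0)"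
      by (metis div_mult_mod_eq)
    finally show "(G * H) $$ (e, f) = 1\<^sub>m N $$ (e, f)" using ef by simp
  qed (use carrier in auto)
  then have "det G * det H = 1"
    using det_mult[OF carrier] by simp
  moreover have "det G = 0"
    unfolding det_0_iff_vec_prod_zero_field[OF carrier(1)]
  \<comment> \<open>Column \<open>l\<close> of \<open>G\<close> lies in the zero padding, and it
    exists because \<open>l < N\<close>.\<close>
  proof (intro exI[of _ "unit_vec N l"] conjI)
    show "G *\<^sub>v unit_vec N l = 0\<^sub>v N"
      using l by (intro eq_vecI) (auto simp: G_def N_def scalar_prod_def unit_vec_def
          if_distrib[of "(*) _"] intro!: sum.neutral)
  qed (use l in \<open>auto simp: N_def unit_vec_nonzero\<close>)
  ultimately show False by simp
qed

text \<open>A function of words over \<open>{..<l}\<close> is an element of a tensor power, with one factor per position of the word.\<close>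

definition digit_op ::
  "nat \<Rightarrow> (nat \<Rightarrow> nat \<Rightarrow> 'a) \<Rightarrow> nat \<Rightarrow> ((nat \<Rightarrow> nat) \<Rightarrow> 'a) \<Rightarrow> (nat \<Rightarrow> nat) \<Rightarrow> 'a::comm_ring_1" where
  "digit_op l a s F w = (\<Sum>e<l. a (w s) e * F (w(s := e)))"

lemma fold_digit_op_sum:
  "fold (digit_op l a) ss (\<lambda>v. \<Sum>c\<in>C. F c v) = (\<lambda>w. \<Sum>c\<in>C. fold (digit_op l a) ss (F c) w)"
proof (induction ss arbitrary: F)
  case (Cons s ss)
  have "digit_op l a s (\<lambda>v. \<Sum>c\<in>C. F c v) = (\<lambda>v. \<Sum>c\<in>C. digit_op l a s (F c) v)"
    unfolding digit_op_def by (subst sum.swap) (simp add: sum_distrib_left)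
  then show ?case by (simp add: Cons.IH)
qed simp

text \<open>The operators vary only letters at the positions \<open>ss\<close>, so the value at
  \<open>w\<close> depends only on words that agree with \<open>w\<close> elsewhere.\<close>

lemma fold_digit_op_cong:
  assumes "\<And>v. (\<And>s. s \<notin> set ss \<Longrightarrow> v s = w s) \<Longrightarrow> F v = G v"
  shows "fold (digit_op l a) ss F w = fold (digit_op l a) ss G w"
  using assms
proof (induction ss arbitrary: F G)
  case (Cons s ss)
  show ?case unfolding fold.simps comp_def
  proof (rule Cons.IH)
    fix v assume "\<And>u. u \<notin> set ss \<Longrightarrow> v u = w u"
    then show "digit_op l a s F v = digit_op l a s G v"
      unfolding digit_op_def by (intro sum.cong refl arg_cong2[of _ _ _ _ "(*)"] Cons.prems) auto
  qed
qed auto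

text \<open>Operators at other positions commute with freezing the letter at \<open>t\<close>. This
  lets an induction split off one position at a time.\<close>

lemma fold_digit_op_upd:
  assumes "t \<notin> set ss"
  shows "fold (digit_op l a) ss F (w(t := e)) = fold (digit_op l a) ss (\<lambda>v. F (v(t := e))) w"
  using assms
proof (induction ss arbitrary: F)
  case (Cons s ss)
  have "(\<lambda>v. digit_op l a s F (v(t := e))) = digit_op l a s (\<lambda>v. F (v(t := e)))"
    using Cons.prems by (auto simp: digit_op_def fun_eq_iff fun_upd_twist)
  then show ?case using Cons.prems by (simp add: Cons.IH del: fun_upd_apply)
qed simp

lemma pair_less_square:
  fixes p q b :: nat
  assumes "p < b" "q < b"
  shows "p * b + q < b * b"
proof -
  have "p * b + q < (p + 1) * b" using assms by simp
  also have "\<dots> \<le> b * b" using assms by (intro mult_right_mono) auto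
  finally show ?thesis .
qed

text \<open>
  The digit \<open>p * n\<^sub>0 + q\<close> stands for position \<open>(p, q)\<close> in each of the three matrices, even though
  \<open>m\<close> may be smaller than \<open>n\<^sub>0\<close>; digits that are not the code of a position have coefficient \<open>0\<close>.
\<close>

locale coded_bilinear =
  fixes n\<^sub>0 m l :: nat and a b g :: "nat \<Rightarrow> nat \<Rightarrow> 'a::field"
  assumes m_le: "m \<le> n\<^sub>0" and square_le: "n\<^sub>0 * n\<^sub>0 \<le> l"
    and brent: "\<And>p r e f. \<lbrakk>p < n\<^sub>0; r < n\<^sub>0; e < l; f < l\<rbrakk> \<Longrightarrow>
      (\<Sum>i<l. g (p * n\<^sub>0 + r) i * a i e * b i f)
      = (\<Sum>q<m. if e = p * n\<^sub>0 + q \<and> f = q * n\<^sub>0 + r then 1 else 0)"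
begin

lemma digit_less: "p < n\<^sub>0 \<Longrightarrow> q < n\<^sub>0 \<Longrightarrow> p * n\<^sub>0 + q < l"
  using pair_less_square square_le by (meson less_le_trans)

text \<open>One level of the recursion: the Brent equations turn combining by \<open>a\<close> and
  \<open>b\<close>, multiplying, and recombining by \<open>g\<close> into the block product over the
  inner digit \<open>q\<close>.\<close>

lemma digit_op_product:
  assumes "p < n\<^sub>0" "r < n\<^sub>0" and w: "w s = p * n\<^sub>0 + r"
  shows "digit_op l g s (\<lambda>v. digit_op l a s A v * digit_op l b s B v) w
    = (\<Sum>q<m. A (w(s := p * n\<^sub>0 + q)) * B (w(s := q * n\<^sub>0 + r)))"
proof -
  let ?A = "\<lambda>e. A (w(s := e))" and ?B = "\<lambda>f. B (w(s := f))"
  have "digit_op l g s (\<lambda>v. digit_op l a s A v * digit_op l b s B v) w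
    = (\<Sum>i<l. \<Sum>e<l. \<Sum>f<l. g (p * n\<^sub>0 + r) i * a i e * b i f * (?A e * ?B f))"
    unfolding digit_op_def w sum_product by (simp add: sum_distrib_left mult_ac)
  \<comment> \<open>The sum over \<open>i\<close> moves innermost, where \<open>brent\<close>
    evaluates it.\<close>
  also have "\<dots> = (\<Sum>e<l. \<Sum>f<l. \<Sum>i<l. g (p * n\<^sub>0 + r) i * a i e * b i f * (?A e * ?B f))"
    by (subst sum.swap) (intro sum.cong refl sum.swap)
  also have "\<dots> = (\<Sum>e<l. \<Sum>f<l. \<Sum>q<m. if e = p * n\<^sub>0 + q \<and> f = q * n\<^sub>0 + r then ?A e * ?B f else 0)"
    using assms by (simp add: sum_distrib_right[symmetric] brent)
      (simp add: sum_distrib_right if_distrib[of "\<lambda>x. x * _"] cong: if_cong)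
  also have "\<dots> = (\<Sum>q<m. \<Sum>e<l. \<Sum>f<l. if e = p * n\<^sub>0 + q \<and> f = q * n\<^sub>0 + r then ?A e * ?B f else 0)"
    by (subst sum.swap[of _ "{..<m}"]) (intro sum.cong refl sum.swap)
  also have "\<dots> = (\<Sum>q<m. ?A (p * n\<^sub>0 + q) * ?B (q * n\<^sub>0 + r))"
  proof (intro sum.cong refl)
    fix q assume "q \<in> {..<m}"
    then have q: "p * n\<^sub>0 + q < l" "q * n\<^sub>0 + r < l"
      using assms m_le by (auto intro!: digit_less)
    have "(\<Sum>e<l. \<Sum>f<l. if e = p * n\<^sub>0 + q \<and> f = q * n\<^sub>0 + r then ?A e * ?B f else 0)
      = (\<Sum>e<l. if e = p * n\<^sub>0 + q then \<Sum>f<l. if f = q * n\<^sub>0 + r then ?A e * ?B f else 0 else 0)"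
      by (intro sum.cong refl) auto
    then show "(\<Sum>e<l. \<Sum>f<l. if e = p * n\<^sub>0 + q \<and> f = q * n\<^sub>0 + r then ?A e * ?B f else 0)
      = ?A (p * n\<^sub>0 + q) * ?B (q * n\<^sub>0 + r)"
      using q by (simp add: sum.delta)
  qed
  finally show ?thesis .
qed

text \<open>Since \<open>g\<close> runs through the positions in reverse, the top position is the
  last one treated by \<open>a\<close> and \<open>b\<close> and the first one treated by
  \<open>g\<close>. The one-letter identity applies there, and the induction continues with
  \<open>A\<close> and \<open>B\<close> frozen at that letter.\<close>

lemma tensor_power_product:
  assumes "\<And>s. s < L \<Longrightarrow> P s < n\<^sub>0 \<and> R s < n\<^sub>0 \<and> w s = P s * n\<^sub>0 + R s"
  shows "fold (digit_op l g) (rev [0..<L])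
      (\<lambda>v. fold (digit_op l a) [0..<L] A v * fold (digit_op l b) [0..<L] B v) w
    = (\<Sum>Q\<in>{..<L} \<rightarrow>\<^sub>E {..<m}. A (\<lambda>s. if s < L then P s * n\<^sub>0 + Q s else w s)
                             * B (\<lambda>s. if s < L then Q s * n\<^sub>0 + R s else w s))"
  using assms
proof (induction L arbitrary: A B)
  case (Suc L)
  let ?a = "fold (digit_op l a) [0..<L]" and ?b = "fold (digit_op l b) [0..<L]"
  let ?A = "\<lambda>q v. A (v(L := P L * n\<^sub>0 + q))" and ?B = "\<lambda>q v. B (v(L := q * n\<^sub>0 + R L))"
  have L: "P L < n\<^sub>0" "R L < n\<^sub>0" "w L = P L * n\<^sub>0 + R L"
    using Suc.prems[of L] by auto
  have "fold (digit_op l g) (rev [0..<Suc L])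
      (\<lambda>v. fold (digit_op l a) [0..<Suc L] A v * fold (digit_op l b) [0..<Suc L] B v) w
    = fold (digit_op l g) (rev [0..<L])
      (digit_op l g L (\<lambda>v. digit_op l a L (?a A) v * digit_op l b L (?b B) v)) w"
    by simp
  also have "\<dots> = fold (digit_op l g) (rev [0..<L]) (\<lambda>v. \<Sum>q<m. ?a (?A q) v * ?b (?B q) v) w"
  \<comment> \<open>The outer operators act only below \<open>L\<close>, so it suffices to consider
    words whose letter at \<open>L\<close> is that of \<open>w\<close>.\<close>
  proof (rule fold_digit_op_cong)
    fix v assume "\<And>s. s \<notin> set (rev [0..<L]) \<Longrightarrow> v s = w s"
    then have "v L = P L * n\<^sub>0 + R L" using L by simp
    from digit_op_product[of _ _ v L, OF L(1,2) this]
    show "digit_op l g L (\<lambda>v. digit_op l a L (?a A) v * digit_op l b L (?b B) v) v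
      = (\<Sum>q<m. ?a (?A q) v * ?b (?B q) v)"
      by (simp add: fold_digit_op_upd)
  qed
  also have "\<dots> = (\<Sum>q<m. fold (digit_op l g) (rev [0..<L]) (\<lambda>v. ?a (?A q) v * ?b (?B q) v) w)"
    by (simp add: fold_digit_op_sum)
  also have "\<dots> = (\<Sum>q<m. \<Sum>Q\<in>{..<L} \<rightarrow>\<^sub>E {..<m}.
      ?A q (\<lambda>s. if s < L then P s * n\<^sub>0 + Q s else w s)
      * ?B q (\<lambda>s. if s < L then Q s * n\<^sub>0 + R s else w s))"
    using Suc.prems by (intro sum.cong refl Suc.IH) auto
  also have "\<dots> = (\<Sum>q<m. \<Sum>Q\<in>{..<L} \<rightarrow>\<^sub>E {..<m}.
      A (\<lambda>s. if s < Suc L then P s * n\<^sub>0 + (Q(L := q)) s else w s)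
      * B (\<lambda>s. if s < Suc L then (Q(L := q)) s * n\<^sub>0 + R s else w s))"
    by (intro sum.cong refl arg_cong2[of _ _ _ _ "(*)"] arg_cong[of _ _ A] arg_cong[of _ _ B])
      (auto simp: fun_eq_iff)
  also have "\<dots> = (\<Sum>Q\<in>{..<Suc L} \<rightarrow>\<^sub>E {..<m}. A (\<lambda>s. if s < Suc L then P s * n\<^sub>0 + Q s else w s)
                             * B (\<lambda>s. if s < Suc L then Q s * n\<^sub>0 + R s else w s))"
    \<comment> \<open>A function on \<open>{..<Suc L}\<close> is a function on \<open>{..<L}\<close>
      together with its value \<open>q\<close> at \<open>L\<close>.\<close>
    unfolding lessThan_Suc PiE_insert_eq sum.cartesian_product
    by (subst sum.reindex[OF inj_combinator]) (simp_all add: case_prod_unfold)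
  finally show ?case .
qed simp

end

text \<open>The digits \<open>e\<close> and \<open>f\<close> run up to \<open>l\<close>, beyond the
  codes of positions, and \<open>m\<close> may be smaller than \<open>n\<close>; hence the guards in
  the first two families. The third is read in \<open>brent\<close> only at genuine codes
  \<open>p * n + r\<close>.\<close>

lemma coded_bilinear_of_algorithm:
  fixes \<alpha> \<beta> :: "nat \<Rightarrow> nat \<times> nat \<Rightarrow> 'a::field"
  assumes alg: "nc_bilinear_algorithm n m n l \<alpha> \<beta> \<gamma>" and m: "0 < m" "m \<le> n"
  shows "coded_bilinear n m l
    (\<lambda>i e. if e div n < n \<and> e mod n < m then \<alpha> i (e div n, e mod n) else 0)
    (\<lambda>i f. if f div n < m then \<beta> i (f div n, f mod n) else 0)
    (\<lambda>e. \<gamma> (e div n, e mod n))" (is "coded_bilinear _ _ _ ?a ?b ?g")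
proof
  show "n * n \<le> l" using nc_bilinear_algorithm_rank[OF alg m(1)] .
  fix p r e f assume h: "p < n" "r < n" "e < l" "f < l"
  have code: "(e = p * n + q \<and> f = q * n + r) \<longleftrightarrow>
      (e div n = p \<and> e mod n = q \<and> f div n = q \<and> f mod n = r)" if "q < m" for q
    using that h m by auto (metis mult.commute mult_div_mod_eq)+
  have "(\<Sum>i<l. ?g (p * n + r) i * ?a i e * ?b i f)
      = (if e div n < n \<and> e mod n < m \<and> f div n < m \<and> e div n = p \<and> e mod n = f div n \<and> f mod n = r
         then 1 else 0)"
  proof (cases "e div n < n \<and> e mod n < m \<and> f div n < m")
    case True
    then show ?thesis
      using nc_bilinear_algorithm_brent[OF alg h(1,2), of "e div n" "e mod n" "f div n" "f mod n"] h m
      by auto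
  qed (auto intro!: sum.neutral)
  \<comment> \<open>At most one summand is nonzero, the one with \<open>q = e mod n\<close>.\<close>
  also have "\<dots> = (\<Sum>q<m. if e div n = p \<and> e mod n = q \<and> f div n = q \<and> f mod n = r then 1 else 0)"
  proof (cases "e div n = p \<and> f mod n = r \<and> e mod n = f div n \<and> e mod n < m")
    case True
    then have "(\<Sum>q<m. if e div n = p \<and> e mod n = q \<and> f div n = q \<and> f mod n = r then 1 else 0)
      = (\<Sum>q<m. if q = e mod n then 1 else (0::'a))"
      by (intro sum.cong) auto
    then show ?thesis using True h by (simp add: sum.delta)
  next
    case False
    then have "(\<Sum>q<m. if e div n = p \<and> e mod n = q \<and> f div n = q \<and> f mod n = r then 1 else 0) = (0::'a)"
      by (intro sum.neutral) auto
    then show ?thesis using False by auto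
  qed
  also have "\<dots> = (\<Sum>q<m. if e = p * n + q \<and> f = q * n + r then 1 else 0)"
    by (intro sum.cong refl) (simp add: code)
  finally show "(\<Sum>i<l. ?g (p * n + r) i * ?a i e * ?b i f)
    = (\<Sum>q<m. if e = p * n + q \<and> f = q * n + r then 1 else 0)" .
qed (use m in auto)

section \<open>Local computations that are oblivious of the values\<close>

text \<open>
  Pairs with equal keys in one memory are the summands of one value. Hence senders that scale their
  data let the receiver form linear combinations without a further round.
\<close>

definition val :: "'a::field memory \<Rightarrow> key \<Rightarrow> 'a" where
  "val mem \<kappa> = (\<Sum>(k, v)\<leftarrow>mem. if k = \<kappa> then v else 0)"

lemma val_append: "val (mem @ mem') \<kappa> = val mem \<kappa> + val mem' \<kappa>"
  by (simp add: val_def)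

lemma val_concat: "val (concat mems) \<kappa> = (\<Sum>mem\<leftarrow>mems. val mem \<kappa>)"
  by (induction mems) (simp_all add: val_append, simp add: val_def)

lemma val_map:
  assumes "distinct ks"
  shows "val (map (\<lambda>k. (k, h k)) ks) \<kappa> = (if \<kappa> \<in> set ks then h \<kappa> else 0)"
  using assms by (induction ks) (auto simp: val_def)

definition expr_sum :: "'a::field expr list \<Rightarrow> 'a expr" where
  "expr_sum es = foldr Plus es (Const 0)"

lemma expr_val_sum: "expr_val vs (expr_sum es) = (\<Sum>e\<leftarrow>es. expr_val vs e)"
  by (induction es) (simp_all add: expr_sum_def)

definition cell_sum :: "key list \<Rightarrow> key \<Rightarrow> 'a::field expr" where
  "cell_sum ks \<kappa> = expr_sum (map Cell (filter (\<lambda>i. ks ! i = \<kappa>) [0..<length ks]))"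

lemma expr_val_cell_sum: "expr_val (map snd mem) (cell_sum (map fst mem) \<kappa>) = val mem \<kappa>"
proof -
  have "expr_val (map snd mem) (cell_sum (map fst mem) \<kappa>)
    = (\<Sum>i\<leftarrow>[0..<length mem]. case mem ! i of (k, v) \<Rightarrow> if k = \<kappa> then v else 0)"
    unfolding cell_sum_def expr_val_sum map_map comp_def sum_list_map_filter'
    by (intro arg_cong[of _ _ sum_list] map_cong) (auto simp: case_prod_unfold)
  also have "\<dots> = (\<Sum>x\<leftarrow>map ((!) mem) [0..<length mem]. case x of (k, v) \<Rightarrow> if k = \<kappa> then v else 0)"
    by (simp add: comp_def)
  finally show ?thesis unfolding map_nth val_def .
qed

text \<open>Destinations, keys and expressions are determined by the stored keys alone, so for each
  key list the set \<open>S\<close> of \<open>local_computation\<close> can be a singleton.\<close>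

definition emit :: "(key list \<Rightarrow> nat \<Rightarrow> (key \<times> 'a::field expr) list) \<Rightarrow> 'a memory \<Rightarrow> nat \<Rightarrow> 'a memory" where
  "emit f mem j = map (\<lambda>(k, e). (k, expr_val (map snd mem) e)) (f (map fst mem) j)"

lemma local_computation_emit: "local_computation (emit f)"
  unfolding local_computation_def emit_def
proof
  fix ks
  show "\<exists>S. finite S \<and> (\<forall>vs :: 'a list. length vs = length ks \<longrightarrow> (\<exists>P\<in>S. \<forall>j.
      map (\<lambda>(k, e). (k, expr_val (map snd (zip ks vs)) e)) (f (map fst (zip ks vs)) j)
      = map (\<lambda>(k, e). (k, expr_val vs e)) (P j)))"
    by (rule exI[of _ "{f ks}"]) simp
qed

text \<open>One round detached from the round number, so that each kind of round can be analysed for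
  an arbitrary state \<open>M\<close>.\<close>

definition exchange :: "nat \<Rightarrow> (nat \<Rightarrow> 'a memory \<Rightarrow> nat \<Rightarrow> 'a memory) \<Rightarrow> (nat \<Rightarrow> 'a memory) \<Rightarrow> nat \<Rightarrow> 'a memory" where
  "exchange p \<rho> M = (\<lambda>j. concat (map (\<lambda>i. \<rho> i (M i) j) [0..<p]))"

lemma mr_run_Suc: "mr_run p \<pi> M (Suc t) = exchange p (\<pi> t) (mr_run p \<pi> M t)"
  by (simp add: exchange_def)

lemma val_exchange: "val (exchange p \<rho> M j) \<kappa> = (\<Sum>i<p. val (\<rho> i (M i) j) \<kappa>)"
  by (simp add: exchange_def val_concat comp_def interv_sum_list_conv_sum_set_nat lessThan_atLeast0)

lemma length_exchange: "length (exchange p \<rho> M j) = (\<Sum>i<p. length (\<rho> i (M i) j))"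
  by (simp add: exchange_def length_concat comp_def interv_sum_list_conv_sum_set_nat lessThan_atLeast0)

lemma concat_map_single:
  "concat (map (\<lambda>i. if j = i then f i else []) [0..<p]) = (if j < p then f j else [])"
  by (induction p) auto

lemma exchange_self:
  assumes "\<And>i j. \<rho> i (M i) j = (if j = i then f i else [])" and "j < p"
  shows "exchange p \<rho> M j = f j"
  using assms(2) by (simp add: exchange_def assms(1) concat_map_single)

lemma sum_length_self:
  assumes "i < (p::nat)"
  shows "(\<Sum>j<p. length (if j = i then xs else [])) = length xs"
  using assms by (simp add: if_distrib[of length] sum.delta cong: if_cong)

lemma distinct_concat_map:
  assumes "\<And>j. j < p \<Longrightarrow> distinct (f j)"
    and "\<And>i j x. i < p \<Longrightarrow> j < p \<Longrightarrow> x \<in> set (f i) \<Longrightarrow> x \<in> set (f j) \<Longrightarrow> i = j"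
  shows "distinct (concat (map f [0..<p]))"
  using assms
proof (induction p)
  case (Suc p)
  have "distinct (concat (map f [0..<p]))"
    by (rule Suc.IH) (use Suc.prems less_SucI in blast)+
  moreover have "set (f i) \<inter> set (f p) = {}" if "i < p" for i
    using Suc.prems(2)[of i p] that by fastforce
  ultimately show ?case using Suc.prems(1)[of p] by fastforce
qed simp

text \<open>An item matches at most one receiver, so routing never duplicates it.\<close>

lemma sum_length_filter_le:
  fixes p :: nat
  assumes "\<And>x i j. i < p \<Longrightarrow> j < p \<Longrightarrow> Q i x \<Longrightarrow> Q j x \<Longrightarrow> i = j"
  shows "(\<Sum>j<p. length (filter (Q j) xs)) \<le> length xs"
proof (induction xs)
  case (Cons x xs)
  have "(\<Sum>j<p. if Q j x then 1 else 0) = card {j\<in>{..<p}. Q j x}"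
    by (simp add: sum.inter_filter[symmetric])
  also have "\<dots> \<le> Suc 0"
    using assms by (intro card_le_Suc0_iff_eq[THEN iffD2]) auto
  finally have "(\<Sum>j<p. if Q j x then 1 else 0) \<le> Suc 0" .
  moreover have "(\<Sum>j<p. length (filter (Q j) (x # xs)))
    = (\<Sum>j<p. if Q j x then 1 else 0) + (\<Sum>j<p. length (filter (Q j) xs))"
    unfolding sum.distrib[symmetric] by (intro sum.cong) auto
  ultimately show ?case using Cons by simp
qed simp

text \<open>Injectivity leaves at most one term in each fibre sum, so cross products of different
  indices never arise. Points of \<open>Z\<close> outside the image are padding and contribute
  \<open>0\<close>.\<close>

lemma sum_fibres:
  fixes x y :: "'k \<Rightarrow> 'a::comm_ring_1"
  assumes "finite Z" "finite K" "inj_on \<psi> K" "\<psi> ` K \<subseteq> Z"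
  shows "(\<Sum>z\<in>Z. (\<Sum>k\<in>K. if \<psi> k = z then x k else 0) * (\<Sum>k\<in>K. if \<psi> k = z then y k else 0))
    = (\<Sum>k\<in>K. x k * y k)"
proof -
  have fibre: "(\<Sum>k\<in>K. if \<psi> k = \<psi> k' then h k else 0) = h k'" if "k' \<in> K" for k' and h :: "'k \<Rightarrow> 'a"
  proof -
    have "(\<Sum>k\<in>K. if \<psi> k = \<psi> k' then h k else 0) = (\<Sum>k\<in>K. if k = k' then h k else 0)"
      using assms(3) that by (intro sum.cong refl) (auto dest: inj_onD)
    then show ?thesis using that assms(2) by (simp add: sum.delta)
  qed
  have "(\<Sum>z\<in>Z. (\<Sum>k\<in>K. if \<psi> k = z then x k else 0) * (\<Sum>k\<in>K. if \<psi> k = z then y k else 0))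
    = (\<Sum>z\<in>\<psi> ` K. (\<Sum>k\<in>K. if \<psi> k = z then x k else 0) * (\<Sum>k\<in>K. if \<psi> k = z then y k else 0))"
  proof (intro sum.mono_neutral_right ballI)
    fix z assume "z \<in> Z - \<psi> ` K"
    then have "(\<Sum>k\<in>K. if \<psi> k = z then x k else 0) = 0" by (intro sum.neutral) auto
    then show "(\<Sum>k\<in>K. if \<psi> k = z then x k else 0) * (\<Sum>k\<in>K. if \<psi> k = z then y k else 0) = 0" by simp
  qed (use assms in auto)
  also have "\<dots> = (\<Sum>k\<in>K. x k * y k)"
    by (simp add: sum.reindex[OF assms(3)] fibre)
  finally show ?thesis .
qed

section \<open>The program\<close>

text \<open>\<open>\<phi>\<close> places the \<open>n\<close> outer indices and
  \<open>\<psi>\<close> the \<open>n'\<close> inner indices: the first component holds the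
  \<open>L\<close> digits of the block coordinate, the second the offset inside the block. Positions
  that are not hit act as zero padding. \<open>wd\<close> names each machine by a word.\<close>

locale mr_tensor = coded_bilinear n\<^sub>0 m l a b g
  for n\<^sub>0 m l :: nat and a b g :: "nat \<Rightarrow> nat \<Rightarrow> 'a::field" +
  fixes L d n n' :: nat
    and \<phi> \<psi> :: "nat \<Rightarrow> (nat \<Rightarrow> nat) \<times> nat"
    and wd :: "nat \<Rightarrow> nat \<Rightarrow> nat"
  assumes wd: "bij_betw wd {..<l ^ L} ({..<L} \<rightarrow>\<^sub>E {..<l})"
    and inj_\<phi>: "inj_on \<phi> {..<n}" and \<phi>_in: "\<phi> ` {..<n} \<subseteq> ({..<L} \<rightarrow>\<^sub>E {..<n\<^sub>0}) \<times> {..<d}"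
    and inj_\<psi>: "inj_on \<psi> {..<n'}" and \<psi>_in: "\<psi> ` {..<n'} \<subseteq> ({..<L} \<rightarrow>\<^sub>E {..<m}) \<times> {..<d}"
    and n'_le: "n' \<le> n" and d_le: "d \<le> n" and l_pos: "l > 0"
begin

abbreviation words :: "(nat \<Rightarrow> nat) set" where "words \<equiv> {..<L} \<rightarrow>\<^sub>E {..<l}"
abbreviation p :: nat where "p \<equiv> l ^ L"
text \<open>Room for one block of each factor, \<open>d\<^sup>2\<close> words apiece, from each of
  \<open>l\<close> neighbours.\<close>

abbreviation cap :: nat where "cap \<equiv> 2 * l * d\<^sup>2"

section \<open>Placement of the matrix entries on the machines\<close>

lemma wd_in: "j < p \<Longrightarrow> wd j \<in> words"
  using wd by (auto simp: bij_betw_def)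

lemma wd_inj: "i < p \<Longrightarrow> j < p \<Longrightarrow> wd i = wd j \<Longrightarrow> i = j"
  using wd by (auto simp: bij_betw_def dest: inj_onD)

lemma wd_surj: "w \<in> words \<Longrightarrow> \<exists>j<p. wd j = w"
  by (metis bij_betw_imp_surj_on imageE lessThan_iff wd)

text \<open>Row and column digits are merged letter by letter into the codes of the bilinear
  algorithm. The restriction makes the result extensional, as membership in \<open>words\<close>
  demands.\<close>

definition pair_word :: "(nat \<Rightarrow> nat) \<Rightarrow> (nat \<Rightarrow> nat) \<Rightarrow> nat \<Rightarrow> nat" where
  "pair_word P Q = (\<lambda>s\<in>{..<L}. P s * n\<^sub>0 + Q s)"

lemma pair_word_in:
  "P \<in> {..<L} \<rightarrow>\<^sub>E {..<n\<^sub>0} \<Longrightarrow> Q \<in> {..<L} \<rightarrow>\<^sub>E {..<n\<^sub>0} \<Longrightarrow> pair_word P Q \<in> words"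
  by (auto simp: pair_word_def PiE_iff intro!: digit_less)

lemma pair_word_inj:
  assumes "P \<in> {..<L} \<rightarrow>\<^sub>E {..<n\<^sub>0}" "Q \<in> {..<L} \<rightarrow>\<^sub>E {..<n\<^sub>0}"
    and "P' \<in> {..<L} \<rightarrow>\<^sub>E {..<n\<^sub>0}" "Q' \<in> {..<L} \<rightarrow>\<^sub>E {..<n\<^sub>0}"
    and eq: "pair_word P Q = pair_word P' Q'"
  shows "P = P' \<and> Q = Q'"
proof -
  have "P s = P' s \<and> Q s = Q' s" if "s < L" for s
  proof -
    have "P s * n\<^sub>0 + Q s = P' s * n\<^sub>0 + Q' s"
      using fun_cong[OF eq, of s] that by (simp add: pair_word_def)
    moreover have "Q s < n\<^sub>0" "Q' s < n\<^sub>0" using assms that by (auto simp: PiE_iff)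
    then have "(P s * n\<^sub>0 + Q s) div n\<^sub>0 = P s" "(P' s * n\<^sub>0 + Q' s) div n\<^sub>0 = P' s"
      "(P s * n\<^sub>0 + Q s) mod n\<^sub>0 = Q s" "(P' s * n\<^sub>0 + Q' s) mod n\<^sub>0 = Q' s"
      by (simp_all add: div_mult_self3)
    ultimately show ?thesis by simp
  qed
  then show ?thesis
    using assms(1-4) by (auto intro!: PiE_ext[of _ "{..<L}"])
qed

text \<open>The matrices \<open>A\<close>, \<open>B\<close> and \<open>A * B\<close> have the numbers \<open>0\<close>, \<open>1\<close> and \<open>2\<close>.\<close>

definition rdim :: "nat \<Rightarrow> nat" where "rdim u = (if u = 1 then n' else n)"
definition cdim :: "nat \<Rightarrow> nat" where "cdim u = (if u = 0 then n' else n)"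
definition rpos :: "nat \<Rightarrow> nat \<Rightarrow> (nat \<Rightarrow> nat) \<times> nat" where "rpos u = (if u = 1 then \<psi> else \<phi>)"
definition cpos :: "nat \<Rightarrow> nat \<Rightarrow> (nat \<Rightarrow> nat) \<times> nat" where "cpos u = (if u = 0 then \<psi> else \<phi>)"

definition keys :: "nat \<Rightarrow> key set" where
  "keys u = {u} \<times> {..<rdim u} \<times> {..<cdim u}"

text \<open>\<open>home\<close> is the word of the machine owning the block of an entry, and
  \<open>loc\<close> is the key used there, with offsets in place of matrix indices.\<close>

fun home :: "key \<Rightarrow> nat \<Rightarrow> nat" where
  "home (u, i, k) = pair_word (fst (rpos u i)) (fst (cpos u k))"

fun loc :: "key \<Rightarrow> key" where
  "loc (u, i, k) = (u, snd (rpos u i), snd (cpos u k))"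

lemma \<phi>_pos: "i < n \<Longrightarrow> fst (\<phi> i) \<in> {..<L} \<rightarrow>\<^sub>E {..<n\<^sub>0} \<and> snd (\<phi> i) < d"
  using \<phi>_in by (auto simp: image_subset_iff mem_Times_iff)

lemma \<psi>_pos: "i < n' \<Longrightarrow> fst (\<psi> i) \<in> {..<L} \<rightarrow>\<^sub>E {..<m} \<and> snd (\<psi> i) < d"
  using \<psi>_in by (auto simp: image_subset_iff mem_Times_iff)

lemma digits_mono: "P \<in> {..<L} \<rightarrow>\<^sub>E {..<m} \<Longrightarrow> P \<in> {..<L} \<rightarrow>\<^sub>E {..<n\<^sub>0}"
  using m_le by (force simp: PiE_iff)

lemma rpos_in: "i < rdim u \<Longrightarrow> fst (rpos u i) \<in> {..<L} \<rightarrow>\<^sub>E {..<n\<^sub>0} \<and> snd (rpos u i) < d"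
  by (cases "u = 1") (simp_all add: rdim_def rpos_def \<phi>_pos \<psi>_pos digits_mono)

lemma cpos_in: "k < cdim u \<Longrightarrow> fst (cpos u k) \<in> {..<L} \<rightarrow>\<^sub>E {..<n\<^sub>0} \<and> snd (cpos u k) < d"
  by (cases "u = 0") (simp_all add: cdim_def cpos_def \<phi>_pos \<psi>_pos digits_mono)

lemma inj_rpos: "inj_on (rpos u) {..<rdim u}"
  using inj_\<phi> inj_\<psi> by (auto simp: rdim_def rpos_def)

lemma inj_cpos: "inj_on (cpos u) {..<cdim u}"
  using inj_\<phi> inj_\<psi> by (auto simp: cdim_def cpos_def)

lemma home_in: "\<kappa> \<in> keys u \<Longrightarrow> home \<kappa> \<in> words"
  by (cases \<kappa>) (simp add: keys_def rpos_in cpos_in pair_word_in)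

lemma loc_in: "\<kappa> \<in> keys u \<Longrightarrow> loc \<kappa> \<in> {u} \<times> {..<d} \<times> {..<d}"
  using rpos_in cpos_in by (auto simp: keys_def)

text \<open>The word reveals both block coordinates digit by digit, \<open>loc\<close> reveals the
  label and the offsets, and the placements are injective.\<close>

lemma home_loc_inj:
  assumes "\<kappa> \<in> keys u" "\<kappa>' \<in> keys u'" and eq: "home \<kappa> = home \<kappa>'" "loc \<kappa> = loc \<kappa>'"
  shows "\<kappa> = \<kappa>'"
proof -
  obtain i k where \<kappa>: "\<kappa> = (u, i, k)" and ik: "i < rdim u" "k < cdim u"
    using assms(1) by (auto simp: keys_def)
  obtain i' k' where \<kappa>': "\<kappa>' = (u', i', k')" and ik': "i' < rdim u'" "k' < cdim u'"
    using assms(2) by (auto simp: keys_def)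
  have u: "u' = u" using eq \<kappa> \<kappa>' by simp
  have "rpos u i = rpos u i'" "cpos u k = cpos u k'"
    using eq pair_word_inj[of "fst (rpos u i)" "fst (cpos u k)" "fst (rpos u i')" "fst (cpos u k')"]
      rpos_in[of i u] cpos_in[of k u] rpos_in[of i' u] cpos_in[of k' u] ik ik'
    by (auto simp: \<kappa> \<kappa>' u intro!: prod_eqI)
  then show ?thesis
    using inj_rpos inj_cpos ik ik' by (auto simp: \<kappa> \<kappa>' u dest: inj_onD)
qed

lemma finite_keys: "finite (keys u)"
  by (simp add: keys_def)

text \<open>On a fixed machine \<open>loc\<close> is injective, and a block has
  \<open>d\<^sup>2\<close> cells.\<close>

lemma card_keys_home_le: "card {\<kappa> \<in> keys u. home \<kappa> = w} \<le> d\<^sup>2"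
proof -
  have "card {\<kappa> \<in> keys u. home \<kappa> = w} \<le> card ({u} \<times> {..<d} \<times> {..<d})"
    by (rule card_inj_on_le[of loc]) (use home_loc_inj loc_in in \<open>auto intro!: inj_onI\<close>)
  then show ?thesis by (simp add: card_cartesian_product power2_eq_square)
qed

lemma card_keys_le: "card (keys u) \<le> p * d\<^sup>2"
proof -
  have fin: "finite words" by (simp add: finite_PiE)
  have "keys u \<subseteq> (\<Union>w\<in>words. {\<kappa> \<in> keys u. home \<kappa> = w})"
    using home_in by auto
  then have "card (keys u) \<le> card (\<Union>w\<in>words. {\<kappa> \<in> keys u. home \<kappa> = w})"
    by (intro card_mono) (auto simp: fin finite_keys)
  also have "\<dots> \<le> (\<Sum>w\<in>words. card {\<kappa> \<in> keys u. home \<kappa> = w})"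
    by (rule card_UN_le[OF fin])
  also have "\<dots> \<le> card words * d\<^sup>2"
    using sum_bounded_above[of words _ "d\<^sup>2"] card_keys_home_le by simp
  finally show ?thesis by (simp add: card_PiE)
qed

text \<open>Indices stay below \<open>n\<close> and labels are at most \<open>2\<close>;
  \<open>n + 3\<close> exceeds both.\<close>

lemma keys_below: "\<kappa> \<in> keys u \<Longrightarrow> u \<le> 2 \<Longrightarrow> key_below (n + 3) \<kappa>"
  using n'_le by (auto simp: keys_def rdim_def cdim_def split: if_splits)

lemma mat_pairs_eq:
  assumes "X \<in> carrier_mat (rdim u) (cdim u)"
  shows "mat_pairs u X = (\<lambda>(u, i, k). ((u, i, k), X $$ (i, k))) ` keys u"
  using assms by (auto simp: mat_pairs_def keys_def image_iff)

section \<open>The local computations of the individual rounds\<close>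

definition cells :: "nat list \<Rightarrow> key list" where
  "cells us = List.product us (List.product [0..<d] [0..<d])"

lemma set_cells: "set (cells us) = set us \<times> {..<d} \<times> {..<d}"
  by (auto simp: cells_def)

lemma length_cells: "length (cells us) = length us * d\<^sup>2"
  by (simp add: cells_def power2_eq_square)

lemma distinct_cells: "distinct us \<Longrightarrow> distinct (cells us)"
  by (simp add: cells_def distinct_product)

definition scatter :: "nat \<Rightarrow> 'a memory \<Rightarrow> nat \<Rightarrow> 'a memory" where
  "scatter j = emit (\<lambda>ks j'.
     map (\<lambda>i. (loc (ks ! i), Cell i)) (filter (\<lambda>i. home (ks ! i) = wd j') [0..<length ks]))"

definition adjacent :: "nat \<Rightarrow> nat \<Rightarrow> nat \<Rightarrow> bool" where
  "adjacent s j j' \<longleftrightarrow> (\<forall>t<L. t \<noteq> s \<longrightarrow> wd j t = wd j' t)"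

text \<open>The sender scales by the coefficient belonging to the receiver's letter, and the
  receiver adds implicitly, since equal keys count as summands. \<open>cell_sum\<close> first merges
  the summands left by the previous round, so memory does not accumulate.\<close>

definition mixing ::
  "nat \<Rightarrow> nat list \<Rightarrow> (nat \<Rightarrow> nat \<Rightarrow> nat \<Rightarrow> 'a) \<Rightarrow> nat \<Rightarrow> 'a memory \<Rightarrow> nat \<Rightarrow> 'a memory" where
  "mixing s us c j = emit (\<lambda>ks j'. if adjacent s j j'
     then map (\<lambda>\<kappa>. (\<kappa>, Times (Const (c (fst \<kappa>) (wd j' s) (wd j s))) (cell_sum ks \<kappa>))) (cells us)
     else [])"

definition multiply :: "nat \<Rightarrow> 'a memory \<Rightarrow> nat \<Rightarrow> 'a memory" where
  "multiply j = emit (\<lambda>ks j'. if j' = j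
     then map (\<lambda>\<kappa>. (\<kappa>, expr_sum (map (\<lambda>q. Times (cell_sum ks (0, fst (snd \<kappa>), q))
                                          (cell_sum ks (1, q, snd (snd \<kappa>)))) [0..<d]))) (cells [2])
     else [])"

text \<open>Only cells of genuine entries regain their matrix indices; the padding is
  discarded.\<close>

definition gather :: "nat \<Rightarrow> 'a memory \<Rightarrow> nat \<Rightarrow> 'a memory" where
  "gather j = emit (\<lambda>ks j'. if j' = j
     then map (\<lambda>\<kappa>. (\<kappa>, cell_sum ks (loc \<kappa>)))
       (filter (\<lambda>\<kappa>. home \<kappa> = wd j) (List.product [2] (List.product [0..<n] [0..<n])))
     else [])"

text \<open>Rounds \<open>1\<close> to \<open>L\<close> mix the factors at positions
  \<open>0\<close> to \<open>L - 1\<close>, and rounds \<open>L + 2\<close> to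
  \<open>2 * L + 1\<close> mix the product in reverse order. Round \<open>2 * L + 2\<close> gathers,
  giving \<open>2 * L + 3\<close> rounds with round \<open>0\<close>. The branch conditions keep
  both subtractions exact.\<close>

definition prog :: "'a program" where
  "prog t = (if t = 0 then scatter
     else if t \<le> L then mixing ([0..<L] ! (t - 1)) [0, 1] (\<lambda>u. if u = 0 then a else b)
     else if t = L + 1 then multiply
     else if t \<le> 2 * L + 1 then mixing (rev [0..<L] ! (t - (L + 2))) [2] (\<lambda>_. g)
     else gather)"

lemma local_computation_prog: "local_computation (prog t i)"
  unfolding prog_def scatter_def mixing_def multiply_def gather_def
  by (simp add: local_computation_emit)

lemma scatter_eq:
  "scatter j mem j' = map (\<lambda>(k, v). (loc k, v)) (filter (\<lambda>(k, v). home k = wd j') mem)"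
proof -
  have "map (\<lambda>(k, v). (loc k, v)) (filter (\<lambda>(k, v). home k = wd j') (map ((!) mem) [0..<length mem]))
    = scatter j mem j'"
    unfolding scatter_def emit_def filter_map map_map comp_def
    by (rule map_cong; (rule filter_cong)?) (auto simp: case_prod_unfold)
  then show ?thesis by (simp only: map_nth)
qed

lemma mixing_eq:
  "mixing s us c j mem j' = (if adjacent s j j'
     then map (\<lambda>\<kappa>. (\<kappa>, c (fst \<kappa>) (wd j' s) (wd j s) * val mem \<kappa>)) (cells us) else [])"
  by (simp add: mixing_def emit_def expr_val_cell_sum)

lemma multiply_eq:
  "multiply j mem j' = (if j' = j
     then map (\<lambda>\<kappa>. (\<kappa>, \<Sum>q<d. val mem (0, fst (snd \<kappa>), q) * val mem (1, q, snd (snd \<kappa>)))) (cells [2])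
     else [])"
  by (simp add: multiply_def emit_def expr_val_sum expr_val_cell_sum comp_def
      interv_sum_list_conv_sum_set_nat lessThan_atLeast0)

lemma gather_eq:
  "gather j mem j' = (if j' = j
     then map (\<lambda>\<kappa>. (\<kappa>, val mem (loc \<kappa>)))
       (filter (\<lambda>\<kappa>. home \<kappa> = wd j) (List.product [2] (List.product [0..<n] [0..<n])))
     else [])"
  by (simp add: gather_def emit_def expr_val_cell_sum comp_def)

section \<open>Invariants and the effect of single rounds\<close>

definition fits :: "(nat \<Rightarrow> 'a memory) \<Rightarrow> bool" where
  "fits M \<longleftrightarrow> (\<forall>j<p. length (M j) \<le> cap \<and> (\<forall>(k, v)\<in>set (M j). key_below (n + 3) k))"

definition sends_fit :: "(nat \<Rightarrow> 'a memory \<Rightarrow> nat \<Rightarrow> 'a memory) \<Rightarrow> (nat \<Rightarrow> 'a memory) \<Rightarrow> bool" where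
  "sends_fit \<rho> M \<longleftrightarrow> (\<forall>i<p. (\<Sum>j<p. length (\<rho> i (M i) j)) \<le> cap)"

text \<open>For each label and offset, the distributed state is a function on words, that is, a
  tensor, whose value at a word sits on the machine of that name.\<close>

definition holds :: "nat list \<Rightarrow> (nat \<Rightarrow> nat \<Rightarrow> nat \<Rightarrow> (nat \<Rightarrow> nat) \<Rightarrow> 'a) \<Rightarrow> (nat \<Rightarrow> 'a memory) \<Rightarrow> bool" where
  "holds us F M \<longleftrightarrow> (\<forall>j<p. \<forall>u\<in>set us. \<forall>r<d. \<forall>c<d. val (M j) (u, r, c) = F u r c (wd j))"

lemma cap_ge: "2 * d\<^sup>2 \<le> cap" "d\<^sup>2 \<le> cap"
  using l_pos by (cases l; simp)+

lemma neighbours: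
  assumes "w' \<in> words" "s < L"
  shows "{w \<in> words. \<forall>t<L. t \<noteq> s \<longrightarrow> w t = w' t} = (\<lambda>e. w'(s := e)) ` {..<l}"
proof (intro equalityI subsetI)
  fix w assume w: "w \<in> {w \<in> words. \<forall>t<L. t \<noteq> s \<longrightarrow> w t = w' t}"
  have "w = w'(s := w s)"
  proof
    fix t show "w t = (w'(s := w s)) t"
      using w assms by (cases "t < L") (auto simp: PiE_iff extensional_def)
  qed
  then show "w \<in> (\<lambda>e. w'(s := e)) ` {..<l}"
    using w assms(2) by (intro image_eqI[of _ _ "w s"]) (auto simp: PiE_iff)
qed (use assms in \<open>auto simp: PiE_iff extensional_def\<close>)

text \<open>The machines adjacent to \<open>j'\<close>, itself included, are indexed by their letter
  at \<open>s\<close>. The same count serves for values, received data and sent data.\<close>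

lemma sum_adjacent:
  fixes h :: "(nat \<Rightarrow> nat) \<Rightarrow> 'b::comm_monoid_add"
  assumes "j' < p" "s < L"
  shows "(\<Sum>j<p. if adjacent s j j' then h (wd j) else 0) = (\<Sum>e<l. h ((wd j')(s := e)))"
proof -
  have "(\<Sum>j<p. if adjacent s j j' then h (wd j) else 0)
    = (\<Sum>w\<in>words. if \<forall>t<L. t \<noteq> s \<longrightarrow> w t = wd j' t then h w else 0)"
    unfolding adjacent_def by (rule sum.reindex_bij_betw[OF wd])
  also have "\<dots> = sum h {w \<in> words. \<forall>t<L. t \<noteq> s \<longrightarrow> w t = wd j' t}"
    by (rule sum.inter_filter[symmetric]) (simp add: finite_PiE)
  also have "\<dots> = (\<Sum>e<l. h ((wd j')(s := e)))"
    unfolding neighbours[OF wd_in[OF assms(1)] assms(2)]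
    by (subst sum.reindex) (auto intro!: inj_onI dest: fun_upd_eqD)
  finally show ?thesis .
qed

lemma adjacent_commute: "adjacent s j j' = adjacent s j' j"
  by (auto simp: adjacent_def)

text \<open>One round of mixing is one application of \<open>digit_op\<close>, for all labels and
  offsets at once. Each machine exchanges at most two blocks with each of \<open>l\<close>
  neighbours, which is where \<open>cap\<close> comes from.\<close>

lemma mixing_step:
  assumes s: "s < L" and us: "distinct us" "length us \<le> 2" "set us \<subseteq> {..2}"
    and M: "holds us F M"
  shows "holds us (\<lambda>u r c. digit_op l (co u) s (F u r c)) (exchange p (mixing s us co) M)"
    and "fits (exchange p (mixing s us co) M)"
    and "sends_fit (mixing s us co) M"
proof -
  have len: "l * length (cells us) \<le> cap"
    using mult_right_mono[OF us(2), of "l * d\<^sup>2"] by (simp add: length_cells mult_ac)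
  show "holds us (\<lambda>u r c. digit_op l (co u) s (F u r c)) (exchange p (mixing s us co) M)"
    unfolding holds_def
  proof (intro allI ballI impI)
    fix j' u r c assume h: "j' < p" "u \<in> set us" "r < d" "c < d"
    have "val (exchange p (mixing s us co) M j') (u, r, c)
      = (\<Sum>j<p. if adjacent s j j' then co u (wd j' s) (wd j s) * F u r c (wd j) else 0)"
      unfolding val_exchange mixing_eq
      using h M distinct_cells[OF us(1)]
      by (intro sum.cong refl) (auto simp: val_map set_cells holds_def, simp add: val_def)
    also have "\<dots> = digit_op l (co u) s (F u r c) (wd j')"
      by (subst sum_adjacent[OF h(1) s, of "\<lambda>w. co u (wd j' s) (w s) * F u r c w"])
        (simp add: digit_op_def)
    finally show "val (exchange p (mixing s us co) M j') (u, r, c)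
      = digit_op l (co u) s (F u r c) (wd j')" .
  qed
  show "fits (exchange p (mixing s us co) M)"
    unfolding fits_def
  proof (intro allI impI conjI)
    fix j' assume j': "j' < p"
    have "length (exchange p (mixing s us co) M j')
      = (\<Sum>j<p. if adjacent s j j' then length (cells us) else 0)"
      unfolding length_exchange mixing_eq by (intro sum.cong) auto
    also have "\<dots> = l * length (cells us)"
      by (subst sum_adjacent[OF j' s]) simp
    finally show "length (exchange p (mixing s us co) M j') \<le> cap" using len by simp
    show "\<forall>(k, v)\<in>set (exchange p (mixing s us co) M j'). key_below (n + 3) k"
      using us(3) d_le by (force simp: exchange_def mixing_eq set_cells split: if_splits)
  qed
  show "sends_fit (mixing s us co) M"
    unfolding sends_fit_def
  proof (intro allI impI)
    fix j assume j: "j < p"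
    \<comment> \<open>Symmetry of adjacency reduces sent data to the count for received
      data.\<close>
    have "(\<Sum>j'<p. length (mixing s us co j (M j) j'))
      = (\<Sum>j'<p. if adjacent s j' j then length (cells us) else 0)"
      unfolding mixing_eq by (intro sum.cong) (auto simp: adjacent_commute)
    also have "\<dots> = l * length (cells us)"
      by (subst sum_adjacent[OF j s]) simp
    finally show "(\<Sum>j'<p. length (mixing s us co j (M j) j')) \<le> cap" using len by simp
  qed
qed

lemma multiply_step:
  assumes "holds [0, 1] F M"
  shows "holds [2] (\<lambda>u r c w. \<Sum>q<d. F 0 r q w * F 1 q c w) (exchange p multiply M)"
    and "fits (exchange p multiply M)"
    and "sends_fit multiply M"
proof -
  have eq: "exchange p multiply M j = map (\<lambda>\<kappa>. (\<kappa>, \<Sum>q<d.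
      val (M j) (0, fst (snd \<kappa>), q) * val (M j) (1, q, snd (snd \<kappa>)))) (cells [2])" if "j < p" for j
    by (rule exchange_self[OF multiply_eq that])
  show "holds [2] (\<lambda>u r c w. \<Sum>q<d. F 0 r q w * F 1 q c w) (exchange p multiply M)"
    using assms by (auto simp: holds_def eq val_map distinct_cells set_cells intro!: sum.cong)
  show "fits (exchange p multiply M)"
    using d_le cap_ge by (auto simp: fits_def eq length_cells set_cells)
  show "sends_fit multiply M"
    using cap_ge by (simp add: sends_fit_def multiply_eq sum_length_self length_cells)
qed

lemma set_gather_keys: "set (List.product [2] (List.product [0..<n] [0..<n])) = keys 2"
  by (auto simp: keys_def rdim_def cdim_def)

text \<open>Every key of the product has exactly one home and \<open>wd\<close> is a bijection onto
  the words, so each output pair is stored exactly once.\<close>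

lemma gather_step:
  assumes M: "holds [2] F M" and C: "C \<in> carrier_mat n n"
    and F: "\<And>i k. i < n \<Longrightarrow> k < n \<Longrightarrow> F 2 (snd (\<phi> i)) (snd (\<phi> k)) (home (2, i, k)) = C $$ (i, k)"
  shows "distributed_among p (exchange p gather M) (mat_pairs 2 C)"
    and "fits (exchange p gather M)"
    and "sends_fit gather M"
proof -
  define ks :: "key list" where "ks = List.product [2] (List.product [0..<n] [0..<n])"
  have ks: "set ks = keys 2" "distinct ks"
    by (simp_all only: ks_def set_gather_keys) (simp add: distinct_product distinct_map inj_on_def)
  have eq: "exchange p gather M j = map (\<lambda>\<kappa>. (\<kappa>, val (M j) (loc \<kappa>))) (filter (\<lambda>\<kappa>. home \<kappa> = wd j) ks)"
    if "j < p" for j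
    unfolding ks_def by (rule exchange_self[OF gather_eq that])
  have entry: "val (M j) (loc (u, i, k)) = C $$ (i, k)"
    if "j < p" "(u, i, k) \<in> keys 2" "home (u, i, k) = wd j" for j u i k
  proof -
    have "u = 2" "i < n" "k < n" using that(2) by (auto simp: keys_def rdim_def cdim_def)
    then show ?thesis
      using M F[of i k] that(1,3) \<phi>_pos[of i] \<phi>_pos[of k]
      by (simp add: holds_def rpos_def cpos_def)
  qed
  have len: "length (filter (\<lambda>\<kappa>. home \<kappa> = wd j) ks) \<le> cap" for j
  proof -
    have "length (filter (\<lambda>\<kappa>. home \<kappa> = wd j) ks) = card (set (filter (\<lambda>\<kappa>. home \<kappa> = wd j) ks))"
      by (rule distinct_card[symmetric]) (simp add: ks(2))
    also have "\<dots> \<le> d\<^sup>2" using card_keys_home_le[of 2 "wd j"] ks(1) by simp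
    finally show ?thesis using cap_ge(2) by linarith
  qed
  show "distributed_among p (exchange p gather M) (mat_pairs 2 C)"
    unfolding distributed_among_def
  proof
    show "distinct (concat (map (exchange p gather M) [0..<p]))"
      by (rule distinct_concat_map)
        (auto simp: eq distinct_map ks(2) intro!: inj_onI dest: wd_inj)
    have "C \<in> carrier_mat (rdim 2) (cdim 2)" using C by (simp add: rdim_def cdim_def)
    from mat_pairs_eq[OF this]
    have pairs: "mat_pairs 2 C = (\<lambda>(u, i, k). ((u, i, k), C $$ (i, k))) ` keys 2" .
    show "set (concat (map (exchange p gather M) [0..<p])) = mat_pairs 2 C"
    proof (intro equalityI subsetI)
      fix x assume "x \<in> set (concat (map (exchange p gather M) [0..<p]))"
      then obtain j \<kappa> where "j < p" "\<kappa> \<in> keys 2" "home \<kappa> = wd j" "x = (\<kappa>, val (M j) (loc \<kappa>))"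
        by (auto simp: eq ks)
      then show "x \<in> mat_pairs 2 C"
        using entry by (cases \<kappa>) (force simp: pairs)
    next
      fix x assume "x \<in> mat_pairs 2 C"
      then obtain u i k where x: "(u, i, k) \<in> keys 2" "x = ((u, i, k), C $$ (i, k))"
        by (auto simp: pairs)
      obtain j where j: "j < p" "wd j = home (u, i, k)"
        using wd_surj[OF home_in[OF x(1)]] by auto
      have "x = ((u, i, k), val (M j) (loc (u, i, k)))"
        using entry[OF j(1) x(1)] j(2) x(2) by simp
      then show "x \<in> set (concat (map (exchange p gather M) [0..<p]))"
        using j x(1) by (auto simp: eq ks intro!: bexI[of _ j] simp del: loc.simps home.simps)
    qed
  qed
  show "fits (exchange p gather M)"
    unfolding fits_def using len keys_below[of _ 2] by (auto simp: eq ks)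
  show "sends_fit gather M"
    unfolding sends_fit_def
    using len by (simp add: gather_eq[folded ks_def] sum_length_self)
qed

end

section \<open>Correctness of the complete run\<close>

context mr_tensor
begin

text \<open>By \<open>home_loc_inj\<close> at most one summand is nonzero; the form of a sum gives
  padding cells the value \<open>0\<close>.\<close>

definition entry :: "(key \<Rightarrow> 'a) \<Rightarrow> nat \<Rightarrow> nat \<Rightarrow> nat \<Rightarrow> (nat \<Rightarrow> nat) \<Rightarrow> 'a" where
  "entry h u r c w = (\<Sum>\<kappa>\<in>keys u. if home \<kappa> = w \<and> loc \<kappa> = (u, r, c) then h \<kappa> else 0)"

text \<open>The initial distribution is arbitrary, but each receiver sees only a filtered part of
  the concatenation of all memories, a distinct list whose set is the graph of
  \<open>h\<close>.\<close>

lemma scatter_step: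
  assumes D: "distributed_among p M ((\<lambda>\<kappa>. (\<kappa>, h \<kappa>)) ` (keys 0 \<union> keys 1))"
    and len: "\<And>j. j < p \<Longrightarrow> length (M j) \<le> cap"
  shows "holds [0, 1] (entry h) (exchange p scatter M)"
    and "fits (exchange p scatter M)"
    and "sends_fit scatter M"
proof -
  define xs where "xs = concat (map M [0..<p])"
  let ?K = "keys 0 \<union> keys 1"
  have xs: "distinct xs" "set xs = (\<lambda>\<kappa>. (\<kappa>, h \<kappa>)) ` ?K"
    using D by (auto simp: distributed_among_def xs_def)
  have eq: "exchange p scatter M j
    = map (\<lambda>(k, v). (loc k, v)) (filter (\<lambda>(k, v). home k = wd j) xs)" for j
    by (simp add: exchange_def scatter_eq xs_def map_concat filter_concat comp_def)
  show "holds [0, 1] (entry h) (exchange p scatter M)"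
    unfolding holds_def
  proof (intro allI ballI impI)
    fix j u r c assume h: "j < p" "u \<in> set [0, 1 :: nat]" "r < d" "c < d"
    have "val (exchange p scatter M j) (u, r, c)
      = (\<Sum>(k, v)\<leftarrow>xs. if home k = wd j \<and> loc k = (u, r, c) then v else 0)"
      unfolding eq val_def by (induction xs) auto
    also have "\<dots> = (\<Sum>(k, v)\<in>set xs. if home k = wd j \<and> loc k = (u, r, c) then v else 0)"
      by (rule sum_list_distinct_conv_sum_set[OF xs(1)])
    also have "\<dots> = (\<Sum>\<kappa>\<in>?K. if home \<kappa> = wd j \<and> loc \<kappa> = (u, r, c) then h \<kappa> else 0)"
      unfolding xs(2) by (subst sum.reindex) (auto intro!: inj_onI)
    also have "\<dots> = entry h u r c (wd j)"
      unfolding entry_def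
    \<comment> \<open>\<open>loc\<close> preserves the label, so keys of the other factor never land
      in these cells.\<close>
    proof (intro sum.mono_neutral_right ballI)
      fix \<kappa> assume "\<kappa> \<in> ?K - keys u"
      then obtain u' where "\<kappa> \<in> keys u'" "u' \<noteq> u" by blast
      then have "loc \<kappa> \<noteq> (u, r, c)" using loc_in by fastforce
      then show "(if home \<kappa> = wd j \<and> loc \<kappa> = (u, r, c) then h \<kappa> else 0) = 0" by simp
    qed (use h(2) finite_keys in auto)
    finally show "val (exchange p scatter M j) (u, r, c) = entry h u r c (wd j)" .
  qed
  show "fits (exchange p scatter M)"
    unfolding fits_def
  proof (intro allI impI conjI)
    fix j assume "j < p"
    have "length (exchange p scatter M j) = card (set (filter (\<lambda>(k, v). home k = wd j) xs))"
      by (subst distinct_card) (simp_all add: xs(1) eq)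
    also have "set (filter (\<lambda>(k, v). home k = wd j) xs)
      = (\<lambda>\<kappa>. (\<kappa>, h \<kappa>)) ` ({\<kappa>\<in>keys 0. home \<kappa> = wd j} \<union> {\<kappa>\<in>keys 1. home \<kappa> = wd j})"
      by (auto simp: xs(2))
    also have "card \<dots> \<le> card {\<kappa>\<in>keys 0. home \<kappa> = wd j} + card {\<kappa>\<in>keys 1. home \<kappa> = wd j}"
      by (rule order_trans[OF card_image_le card_Un_le]) (simp add: finite_keys)
    also have "\<dots> \<le> 2 * d\<^sup>2"
      using card_keys_home_le[of 0 "wd j"] card_keys_home_le[of 1 "wd j"] by linarith
    finally show "length (exchange p scatter M j) \<le> cap" using cap_ge by linarith
    have "key_below (n + 3) (loc \<kappa>)" if "\<kappa> \<in> ?K" for \<kappa>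
      using loc_in[of \<kappa> 0] loc_in[of \<kappa> 1] that d_le by auto
    then show "\<forall>(k, v)\<in>set (exchange p scatter M j). key_below (n + 3) k"
      by (auto simp: eq xs(2) simp del: loc.simps home.simps key_below.simps)
  qed
  show "sends_fit scatter M"
    unfolding sends_fit_def
  proof (intro allI impI)
    fix i assume i: "i < p"
    have "(\<Sum>j<p. length (scatter i (M i) j)) \<le> length (M i)"
      unfolding scatter_eq length_map by (rule sum_length_filter_le) (auto dest: wd_inj)
    then show "(\<Sum>j<p. length (scatter i (M i) j)) \<le> cap" using len[OF i] by linarith
  qed
qed

text \<open>The block row and row offset identify row \<open>i\<close> because \<open>\<phi>\<close>
  is injective; only the inner index remains, in the form that \<open>sum_fibres\<close>
  expects.\<close>

lemma entry_left:
  assumes i: "i < n" and Q: "Q \<in> {..<L} \<rightarrow>\<^sub>E {..<m}"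
  shows "entry h 0 (snd (\<phi> i)) c (pair_word (fst (\<phi> i)) Q) = (\<Sum>k<n'. if \<psi> k = (Q, c) then h (0, i, k) else 0)"
proof -
  have iff: "home (0, i', k) = pair_word (fst (\<phi> i)) Q \<and> loc (0, i', k) = (0, snd (\<phi> i), c)
    \<longleftrightarrow> i' = i \<and> \<psi> k = (Q, c)" if "i' < n" "k < n'" for i' k
  proof
    assume h: "home (0, i', k) = pair_word (fst (\<phi> i)) Q \<and> loc (0, i', k) = (0, snd (\<phi> i), c)"
    then have "fst (\<phi> i') = fst (\<phi> i) \<and> fst (\<psi> k) = Q"
      using pair_word_inj[of "fst (\<phi> i')" "fst (\<psi> k)" "fst (\<phi> i)" Q] \<phi>_pos \<psi>_pos digits_mono that i Q
      by (simp add: rpos_def cpos_def)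
    then show "i' = i \<and> \<psi> k = (Q, c)"
      using h that i inj_onD[OF inj_\<phi>, of i' i] by (auto simp: rpos_def cpos_def prod_eq_iff)
  qed (auto simp: rpos_def cpos_def)
  have "entry h 0 (snd (\<phi> i)) c (pair_word (fst (\<phi> i)) Q)
    = (\<Sum>\<kappa>\<in>(\<lambda>k. (0, i, k)) ` {..<n'}. if home \<kappa> = pair_word (fst (\<phi> i)) Q \<and> loc \<kappa> = (0, snd (\<phi> i), c) then h \<kappa> else 0)"
    unfolding entry_def
  proof (intro sum.mono_neutral_right ballI)
    fix \<kappa> assume "\<kappa> \<in> keys 0 - (\<lambda>k. (0, i, k)) ` {..<n'}"
    then obtain i' k where \<kappa>: "\<kappa> = (0, i', k)" "i' < n" "k < n'" "i' \<noteq> i"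
      by (auto simp: keys_def rdim_def cdim_def)
    show "(if home \<kappa> = pair_word (fst (\<phi> i)) Q \<and> loc \<kappa> = (0, snd (\<phi> i), c) then h \<kappa> else 0) = 0"
      unfolding \<kappa>(1) iff[OF \<kappa>(2,3)] using \<kappa>(4) by simp
  qed (use i in \<open>auto simp: keys_def rdim_def cdim_def\<close>)
  also have "\<dots> = (\<Sum>k<n'. if \<psi> k = (Q, c) then h (0, i, k) else 0)"
    by (subst sum.reindex, simp add: inj_on_def, intro sum.cong refl)
      (simp only: comp_def iff[OF i] lessThan_iff simp_thms)
  finally show ?thesis .
qed

text \<open>Mirror image for the second factor, with its column fixed by
  \<open>\<phi>\<close>.\<close>

lemma entry_right:
  assumes i: "i < n" and Q: "Q \<in> {..<L} \<rightarrow>\<^sub>E {..<m}"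
  shows "entry h 1 r (snd (\<phi> i)) (pair_word Q (fst (\<phi> i))) = (\<Sum>k<n'. if \<psi> k = (Q, r) then h (1, k, i) else 0)"
proof -
  have iff: "home (1, k, i') = pair_word Q (fst (\<phi> i)) \<and> loc (1, k, i') = (1, r, snd (\<phi> i))
    \<longleftrightarrow> i' = i \<and> \<psi> k = (Q, r)" if "i' < n" "k < n'" for i' k
  proof
    assume h: "home (1, k, i') = pair_word Q (fst (\<phi> i)) \<and> loc (1, k, i') = (1, r, snd (\<phi> i))"
    then have "fst (\<phi> i') = fst (\<phi> i) \<and> fst (\<psi> k) = Q"
      using pair_word_inj[of "fst (\<psi> k)" "fst (\<phi> i')" Q "fst (\<phi> i)"] \<phi>_pos \<psi>_pos digits_mono that i Q
      by (simp add: rpos_def cpos_def)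
    then show "i' = i \<and> \<psi> k = (Q, r)"
      using h that i inj_onD[OF inj_\<phi>, of i' i] by (auto simp: rpos_def cpos_def prod_eq_iff)
  qed (auto simp: rpos_def cpos_def)
  have "entry h 1 r (snd (\<phi> i)) (pair_word Q (fst (\<phi> i)))
    = (\<Sum>\<kappa>\<in>(\<lambda>k. (1, k, i)) ` {..<n'}. if home \<kappa> = pair_word Q (fst (\<phi> i)) \<and> loc \<kappa> = (1, r, snd (\<phi> i)) then h \<kappa> else 0)"
    unfolding entry_def
  proof (intro sum.mono_neutral_right ballI)
    fix \<kappa> assume "\<kappa> \<in> keys 1 - (\<lambda>k. (1, k, i)) ` {..<n'}"
    then obtain i' k where \<kappa>: "\<kappa> = (1, k, i')" "i' < n" "k < n'" "i' \<noteq> i"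
      by (auto simp: keys_def rdim_def cdim_def)
    show "(if home \<kappa> = pair_word Q (fst (\<phi> i)) \<and> loc \<kappa> = (1, r, snd (\<phi> i)) then h \<kappa> else 0) = 0"
      unfolding \<kappa>(1) iff[OF \<kappa>(2,3)] using \<kappa>(4) by simp
  qed (use i in \<open>auto simp: keys_def rdim_def cdim_def\<close>)
  also have "\<dots> = (\<Sum>k<n'. if \<psi> k = (Q, r) then h (1, k, i) else 0)"
    by (subst sum.reindex, simp add: inj_on_def, intro sum.cong refl)
      (simp only: comp_def iff[OF i] lessThan_iff simp_thms)
  finally show ?thesis .
qed

text \<open>The tensor power identity sums over block coordinates \<open>Q\<close>, the local
  products over offsets \<open>q\<close>. Together they range over all padded inner positions, and
  both factors place inner indices by the same \<open>\<psi>\<close>, so the fibres collapse to the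
  ordinary inner product.\<close>

lemma product_entry:
  assumes "i < n" "k < n"
  shows "fold (digit_op l g) (rev [0..<L])
      (\<lambda>w. \<Sum>q<d. fold (digit_op l a) [0..<L] (entry h 0 (snd (\<phi> i)) q) w
                * fold (digit_op l b) [0..<L] (entry h 1 q (snd (\<phi> k))) w) (home (2, i, k))
    = (\<Sum>j<n'. h (0, i, j) * h (1, j, k))"
proof -
  let ?P = "fst (\<phi> i)" and ?R = "fst (\<phi> k)" and ?Q = "{..<L} \<rightarrow>\<^sub>E {..<m}"
  have word: "(\<lambda>s. if s < L then P s * n\<^sub>0 + Q s else home (2, i, k) s) = pair_word P Q" for P Q
    by (auto simp: fun_eq_iff pair_word_def)
  have digits: "?P s < n\<^sub>0 \<and> ?R s < n\<^sub>0 \<and> home (2, i, k) s = ?P s * n\<^sub>0 + ?R s" if "s < L" for s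
    using \<phi>_pos[OF assms(1)] \<phi>_pos[OF assms(2)] that
    by (auto simp: PiE_iff pair_word_def rpos_def cpos_def)
  have "fold (digit_op l g) (rev [0..<L])
      (\<lambda>w. \<Sum>q<d. fold (digit_op l a) [0..<L] (entry h 0 (snd (\<phi> i)) q) w
                * fold (digit_op l b) [0..<L] (entry h 1 q (snd (\<phi> k))) w) (home (2, i, k))
    = (\<Sum>q<d. \<Sum>Q\<in>?Q. entry h 0 (snd (\<phi> i)) q (pair_word ?P Q) * entry h 1 q (snd (\<phi> k)) (pair_word Q ?R))"
    unfolding fold_digit_op_sum
    by (intro sum.cong refl) (subst tensor_power_product[OF digits]; simp only: word)
  also have "\<dots> = (\<Sum>q<d. \<Sum>Q\<in>?Q. (\<Sum>j<n'. if \<psi> j = (Q, q) then h (0, i, j) else 0)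
                          * (\<Sum>j<n'. if \<psi> j = (Q, q) then h (1, j, k) else 0))"
    by (intro sum.cong refl) (simp only: entry_left[OF assms(1)] entry_right[OF assms(2)])
  also have "\<dots> = (\<Sum>z\<in>?Q \<times> {..<d}. (\<Sum>j<n'. if \<psi> j = z then h (0, i, j) else 0)
                          * (\<Sum>j<n'. if \<psi> j = z then h (1, j, k) else 0))"
    by (subst sum.swap) (simp add: sum.cartesian_product case_prod_unfold)
  also have "\<dots> = (\<Sum>j<n'. h (0, i, j) * h (1, j, k))"
    by (rule sum_fibres) (use inj_\<psi> \<psi>_in in \<open>auto simp: finite_PiE\<close>)
  finally show ?thesis .
qed

text \<open>The starting round \<open>t0\<close> is free, so the statement serves both the descent
  with \<open>a\<close>, \<open>b\<close> and the ascent with \<open>g\<close>. The bounds are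
  collected for every round on the way.\<close>

lemma mixing_phase:
  assumes ss: "set ss \<subseteq> {..<L}" and us: "distinct us" "length us \<le> 2" "set us \<subseteq> {..2}"
    and prog: "\<And>t. t < length ss \<Longrightarrow> prog (t0 + t) = mixing (ss ! t) us co"
    and M: "holds us F (mr_run p prog M t0)" "fits (mr_run p prog M t0)"
  shows "t \<le> length ss \<Longrightarrow>
    holds us (\<lambda>u r c. fold (digit_op l (co u)) (take t ss) (F u r c)) (mr_run p prog M (t0 + t))
    \<and> (\<forall>t'\<in>{t0..t0 + t}. fits (mr_run p prog M t'))
    \<and> (\<forall>t'\<in>{t0..<t0 + t}. sends_fit (prog t') (mr_run p prog M t'))"
proof (induction t)
  case 0
  then show ?case using M by simp
next
  case (Suc t)
  have "ss ! t < L" using subsetD[OF ss nth_mem[of t]] Suc.prems by simp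
  note step = mixing_step[OF this us conjunct1[OF Suc.IH[OF Suc_leD[OF Suc.prems]]], of co]
  have t: "prog (t0 + t) = mixing (ss ! t) us co" using prog[of t] Suc.prems by simp
  then have run: "mr_run p prog M (t0 + Suc t) = exchange p (mixing (ss ! t) us co) (mr_run p prog M (t0 + t))"
    by (simp only: add_Suc_right mr_run_Suc)
  have "holds us (\<lambda>u r c. fold (digit_op l (co u)) (take (Suc t) ss) (F u r c)) (mr_run p prog M (t0 + Suc t))"
    using step(1) Suc.prems unfolding run by (simp add: take_Suc_conv_app_nth)
  moreover have "fits (mr_run p prog M (t0 + Suc t))"
    unfolding run by (rule step(2))
  moreover have "sends_fit (prog (t0 + t)) (mr_run p prog M (t0 + t))"
    unfolding t by (rule step(3))
  moreover have "{t0..t0 + Suc t} = insert (t0 + Suc t) {t0..t0 + t}" "{t0..<t0 + Suc t} = insert (t0 + t) {t0..<t0 + t}"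
    by auto
  ultimately show ?case
    using Suc.IH[OF Suc_leD[OF Suc.prems]] by (simp only: ball_simps simp_thms) (elim conjE, intro conjI)
qed

lemma prog_computes:
  assumes A: "A \<in> carrier_mat n n'" and B: "B \<in> carrier_mat n' n"
  shows "mr_computes p cap (n + 3) (2 * L + 3) prog (mat_pairs 0 A \<union> mat_pairs 1 B) (mat_pairs 2 (A * B))"
proof -
  define h :: "key \<Rightarrow> 'a" where "h = (\<lambda>(u, i, k). (if u = 0 then A else B) $$ (i, k))"
  have "A \<in> carrier_mat (rdim 0) (cdim 0)" "B \<in> carrier_mat (rdim 1) (cdim 1)"
    using A B by (simp_all add: rdim_def cdim_def)
  then have "mat_pairs 0 A = (\<lambda>\<kappa>. (\<kappa>, h \<kappa>)) ` keys 0" "mat_pairs 1 B = (\<lambda>\<kappa>. (\<kappa>, h \<kappa>)) ` keys 1"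
    by (simp_all only: mat_pairs_eq) (auto simp: h_def keys_def intro!: image_cong)
  then have D: "mat_pairs 0 A \<union> mat_pairs 1 B = (\<lambda>\<kappa>. (\<kappa>, h \<kappa>)) ` (keys 0 \<union> keys 1)"
    by (simp only: image_Un)
  have card: "card (mat_pairs 0 A \<union> mat_pairs 1 B) \<le> p * cap"
  proof -
    have "card (mat_pairs 0 A \<union> mat_pairs 1 B) \<le> card (keys 0) + card (keys 1)"
      unfolding D by (rule order_trans[OF card_image_le card_Un_le]) (simp add: finite_keys)
    also have "\<dots> \<le> p * (2 * d\<^sup>2)" using card_keys_le[of 0] card_keys_le[of 1] by simp
    also have "\<dots> \<le> p * cap" by (intro mult_left_mono cap_ge) simp
    finally show ?thesis .
  qed
  have "(\<forall>t\<le>2 * L + 3. fits (mr_run p prog M t))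
      \<and> (\<forall>t<2 * L + 3. sends_fit (prog t) (mr_run p prog M t))
      \<and> distributed_among p (mr_run p prog M (2 * L + 3)) (mat_pairs 2 (A * B))"
    if M: "distributed_among p M (mat_pairs 0 A \<union> mat_pairs 1 B)" "\<forall>i<p. length (M i) \<le> cap" for M
  proof -
    let ?R = "mr_run p prog M"
    define co where "co = (\<lambda>u::nat. if u = 0 then a else b)"
    \<comment> \<open>\<open>F\<close>, \<open>G\<close> and \<open>H\<close> are the tensors held
      after the descent, the block products and the ascent.\<close>
    define F where "F = (\<lambda>u r c. fold (digit_op l (co u)) [0..<L] (entry h u r c))"
    define G where "G = (\<lambda>(u::nat) r c w. \<Sum>q<d. F 0 r q w * F 1 q c w)"
    define H where "H = (\<lambda>u r c. fold (digit_op l g) (rev [0..<L]) (G u r c))"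
    have fits0: "fits (?R 0)"
      unfolding fits_def
    proof (intro allI impI conjI)
      fix j assume j: "j < p"
      have "set (M j) \<subseteq> mat_pairs 0 A \<union> mat_pairs 1 B"
        using M(1) j by (auto simp: distributed_among_def)
      then have "set (M j) \<subseteq> (\<lambda>\<kappa>. (\<kappa>, h \<kappa>)) ` (keys 0 \<union> keys 1)"
        by (simp only: D)
      then show "\<forall>(k, v)\<in>set (?R 0 j). key_below (n + 3) k"
        using keys_below[of _ 0] keys_below[of _ 1] by auto
    qed (use M in simp)
    have R1: "?R 1 = exchange p scatter (?R 0)"
      by (simp only: One_nat_def mr_run_Suc) (simp add: prog_def)
    note s1 = scatter_step[of M h, folded D, OF M(1) M(2)[rule_format]]
    have "holds [0, 1] (\<lambda>u r c. fold (digit_op l (co u)) (take L [0..<L]) (entry h u r c)) (?R (1 + L))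
        \<and> (\<forall>t\<in>{1..1 + L}. fits (?R t)) \<and> (\<forall>t\<in>{1..<1 + L}. sends_fit (prog t) (?R t))"
    proof (rule mixing_phase)
      show "prog (1 + t) = mixing ([0..<L] ! t) [0, 1] co" if "t < length [0..<L]" for t
        using that by (simp add: prog_def co_def)
      show "holds [0, 1] (entry h) (?R 1)" "fits (?R 1)"
        unfolding R1 using s1 by simp_all
    qed auto
    then have down: "holds [0, 1] F (?R (L + 1))" "\<forall>t\<in>{1..L + 1}. fits (?R t)"
      "\<forall>t\<in>{1..<L + 1}. sends_fit (prog t) (?R t)"
      by (simp_all add: F_def del: mr_run.simps)
    have prog_mul: "prog (L + 1) = multiply" by (simp add: prog_def)
    then have RL: "?R (L + 2) = exchange p multiply (?R (L + 1))"
      using mr_run_Suc[of p prog M "L + 1"] by simp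
    note s2 = multiply_step[OF down(1), folded RL]
    have "holds [2] (\<lambda>u r c. fold (digit_op l g) (take L (rev [0..<L])) (G u r c)) (?R (L + 2 + L))
        \<and> (\<forall>t\<in>{L + 2..L + 2 + L}. fits (?R t)) \<and> (\<forall>t\<in>{L + 2..<L + 2 + L}. sends_fit (prog t) (?R t))"
    proof (rule mixing_phase)
      show "prog (L + 2 + t) = mixing (rev [0..<L] ! t) [2] (\<lambda>_. g)" if "t < length (rev [0..<L])" for t
        using that by (simp add: prog_def)
      show "holds [2] G (?R (L + 2))" "fits (?R (L + 2))"
        using s2 unfolding G_def by simp_all
    qed auto
    moreover have "L + 2 + L = 2 * L + 2" "take L (rev [0..<L]) = rev [0..<L]" by simp_all
    ultimately have up: "holds [2] H (?R (2 * L + 2))" "\<forall>t\<in>{L + 2..2 * L + 2}. fits (?R t)"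
      "\<forall>t\<in>{L + 2..<2 * L + 2}. sends_fit (prog t) (?R t)"
      unfolding H_def by (simp_all only: simp_thms) blast+
    have prog_gather: "prog (2 * L + 2) = gather" by (simp add: prog_def)
    then have RT: "?R (2 * L + 3) = exchange p gather (?R (2 * L + 2))"
      using mr_run_Suc[of p prog M "2 * L + 2"] by (simp add: numeral_3_eq_3)
    have "H 2 (snd (\<phi> i)) (snd (\<phi> k)) (home (2, i, k)) = (A * B) $$ (i, k)" if "i < n" "k < n" for i k
    proof -
      have "H 2 (snd (\<phi> i)) (snd (\<phi> k)) (home (2, i, k)) = (\<Sum>j<n'. h (0, i, j) * h (1, j, k))"
        using product_entry[OF that] by (simp add: H_def G_def F_def co_def)
      then show ?thesis
        using A B that by (simp add: h_def scalar_prod_def lessThan_atLeast0)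
    qed
    note s3 = gather_step[OF up(1) mult_carrier_mat[OF A B] this, folded RT]
    have "fits (?R t)" if "t \<le> 2 * L + 3" for t
    proof -
      consider "t = 0" | "t \<in> {1..L + 1}" | "t \<in> {L + 2..2 * L + 2}" | "t = 2 * L + 3"
        using \<open>t \<le> _\<close> by force
      then show ?thesis using fits0 down(2) up(2) s3(2) by cases blast+
    qed
    moreover have "sends_fit (prog t) (?R t)" if "t < 2 * L + 3" for t
    proof -
      consider "t = 0" | "t \<in> {1..<L + 1}" | "t = L + 1" | "t \<in> {L + 2..<2 * L + 2}" | "t = 2 * L + 2"
        using \<open>t < _\<close> by force
      then show ?thesis
      proof cases
        case 1
        then show ?thesis using s1(3) by (simp add: prog_def)
      qed (use down(3) up(3) s2(3) s3(3) prog_mul prog_gather in \<open>simp_all only:\<close>)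
    qed
    ultimately show ?thesis using s3(1) by blast
  qed
  then show ?thesis
    unfolding mr_computes_def fits_def sends_fit_def using card by blast
qed

end

text \<open>The placements may be arbitrary injections, so counting alone supplies them: the padded
  index sets have \<open>n\<^sub>0 ^ L * d\<close> and \<open>m ^ L * d\<close> elements.\<close>

lemma mr_program_exists:
  fixes \<alpha> \<beta> :: "nat \<Rightarrow> nat \<times> nat \<Rightarrow> 'a::field"
  assumes alg: "nc_bilinear_algorithm n\<^sub>0 m n\<^sub>0 l \<alpha> \<beta> \<gamma>" and m: "0 < m" "m \<le> n\<^sub>0"
    and n: "n \<le> n\<^sub>0 ^ L * d" and n': "n' \<le> m ^ L * d" "n' \<le> n" and d: "d \<le> n"
  shows "\<exists>\<pi> :: 'a program. (\<forall>t i. local_computation (\<pi> t i)) \<and>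
    (\<forall>A \<in> carrier_mat n n'. \<forall>B \<in> carrier_mat n' n.
      mr_computes (l ^ L) (2 * l * d\<^sup>2) (n + 3) (2 * L + 3) \<pi>
        (mat_pairs 0 A \<union> mat_pairs 1 B) (mat_pairs 2 (A * B)))"
proof -
  obtain a b g :: "nat \<Rightarrow> nat \<Rightarrow> 'a" where coded: "coded_bilinear n\<^sub>0 m l a b g"
    using coded_bilinear_of_algorithm[OF alg m] by blast
  have l: "l > 0"
    using coded_bilinear.square_le[OF coded] m by (cases l) auto
  have "\<exists>wd. bij_betw wd {..<l ^ L} ({..<L} \<rightarrow>\<^sub>E {..<l})"
    by (rule finite_same_card_bij) (simp_all add: finite_PiE card_PiE)
  then obtain wd where wd: "bij_betw wd {..<l ^ L} ({..<L} \<rightarrow>\<^sub>E {..<l})" ..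
  have "\<exists>\<phi>. inj_on \<phi> {..<n} \<and> \<phi> ` {..<n} \<subseteq> ({..<L} \<rightarrow>\<^sub>E {..<n\<^sub>0}) \<times> {..<d}"
    using n by (subst inj_on_iff_card_le) (simp_all add: finite_PiE card_PiE card_cartesian_product)
  then obtain \<phi> where \<phi>: "inj_on \<phi> {..<n}" "\<phi> ` {..<n} \<subseteq> ({..<L} \<rightarrow>\<^sub>E {..<n\<^sub>0}) \<times> {..<d}"
    by blast
  have "\<exists>\<psi>. inj_on \<psi> {..<n'} \<and> \<psi> ` {..<n'} \<subseteq> ({..<L} \<rightarrow>\<^sub>E {..<m}) \<times> {..<d}"
    using n' by (subst inj_on_iff_card_le) (simp_all add: finite_PiE card_PiE card_cartesian_product)
  then obtain \<psi> where \<psi>: "inj_on \<psi> {..<n'}" "\<psi> ` {..<n'} \<subseteq> ({..<L} \<rightarrow>\<^sub>E {..<m}) \<times> {..<d}"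
    by blast
  interpret mr_tensor n\<^sub>0 m l a b g L d n n' \<phi> \<psi> wd
    by (intro mr_tensor.intro coded mr_tensor_axioms.intro wd \<phi> \<psi> n'(2) d l)
  show ?thesis
    using local_computation_prog prog_computes by blast
qed

section \<open>The choice of the parameters\<close>

lemma inner_dim_pos: "n \<ge> 1 \<Longrightarrow> inner_dim x n \<ge> 1"
  by (simp add: inner_dim_def Suc_le_eq)

lemma powr_le_inner_dim: "real n powr x \<le> real (inner_dim x n)"
  unfolding inner_dim_def by linarith

lemma inner_dim_le:
  assumes "n \<ge> 1" and "real n powr x \<le> real k"
  shows "inner_dim x n \<le> k"
  using assms unfolding inner_dim_def by linarith

context
  fixes x \<epsilon> \<omega> :: real and n\<^sub>0 l n :: nat
  assumes x: "0 < x" "x < 1" and n\<^sub>0: "n\<^sub>0 \<ge> 2" and \<epsilon>: "\<epsilon> \<ge> 0" and n: "n \<ge> 1"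
begin

text \<open>The least number of levels with \<open>n\<^sub>0 ^ depth\<close> at least
  \<open>n powr (1 - \<epsilon> / 2)\<close>; for \<open>\<epsilon> > 2\<close> it is
  \<open>0\<close>.\<close>

definition depth :: nat where "depth = nat \<lceil>(1 - \<epsilon> / 2) * log (real n\<^sub>0) (real n)\<rceil>"
definition block :: nat where "block = nat \<lceil>real n / real n\<^sub>0 ^ depth\<rceil>"

lemma log_nonneg: "log (real n\<^sub>0) (real n) \<ge> 0"
  using n\<^sub>0 n by simp

lemma depth_le: "real depth \<le> log (real n\<^sub>0) (real n) + 1"
proof -
  have "(1 - \<epsilon> / 2) * log (real n\<^sub>0) (real n) \<le> 1 * log (real n\<^sub>0) (real n)"
    using log_nonneg \<epsilon> by (intro mult_right_mono) auto
  then show ?thesis unfolding depth_def using log_nonneg by linarith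
qed

lemma powr_mult_log: "real n\<^sub>0 powr (c * log (real n\<^sub>0) (real n)) = real n powr c"
proof -
  have "real n\<^sub>0 powr (log (real n\<^sub>0) (real n) * c) = (real n\<^sub>0 powr log (real n\<^sub>0) (real n)) powr c"
    by (simp add: powr_powr)
  then show ?thesis using n\<^sub>0 n by (simp add: mult.commute)
qed

lemma block_pos: "block \<ge> 1"
  using n\<^sub>0 n by (simp add: block_def Suc_le_eq)

lemma block_le: "block \<le> n"
proof -
  have "real n / real n\<^sub>0 ^ depth \<le> real n / 1"
    using n\<^sub>0 by (intro divide_left_mono) auto
  then show ?thesis unfolding block_def by linarith
qed

lemma le_power_block: "n \<le> n\<^sub>0 ^ depth * block"
proof -
  have "real n / real n\<^sub>0 ^ depth \<le> real block" unfolding block_def by linarith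
  then have "real n \<le> real (n\<^sub>0 ^ depth * block)"
    using n\<^sub>0 by (simp add: divide_le_eq mult.commute)
  then show ?thesis by (simp only: of_nat_le_iff)
qed

text \<open>Raise \<open>n \<le> n\<^sub>0 ^ depth * block\<close> to the power \<open>x\<close>:
  each factor \<open>n\<^sub>0 powr x\<close> is at most the inner dimension of the base algorithm,
  and \<open>block powr x\<close> at most \<open>block\<close>. The bound is an integer and so
  absorbs the ceiling.\<close>

lemma inner_dim_le_power_block: "inner_dim x n \<le> inner_dim x n\<^sub>0 ^ depth * block"
proof (rule inner_dim_le[OF n])
  have "real n powr x \<le> real (n\<^sub>0 ^ depth * block) powr x"
    using x le_power_block by (intro powr_mono2) (auto simp del: of_nat_mult)
  also have "\<dots> = (real n\<^sub>0 powr x) ^ depth * real block powr x"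
    using n\<^sub>0 by (simp add: powr_mult powr_realpow[symmetric] powr_powr mult.commute)
  also have "\<dots> \<le> real (inner_dim x n\<^sub>0) ^ depth * real block powr 1"
    using block_pos x by (intro mult_mono power_mono powr_le_inner_dim powr_mono) auto
  finally show "real n powr x \<le> real (inner_dim x n\<^sub>0 ^ depth * block)"
    using block_pos by simp
qed

text \<open>Rounding up adds at most \<open>1\<close>, which the factor \<open>2\<close> absorbs
  because \<open>n powr (\<epsilon> / 2) \<ge> 1\<close>.\<close>

lemma block_le_powr: "real block \<le> 2 * real n powr (\<epsilon> / 2)"
proof -
  have "real n powr (1 - \<epsilon> / 2) = real n\<^sub>0 powr ((1 - \<epsilon> / 2) * log (real n\<^sub>0) (real n))"
    by (rule powr_mult_log[symmetric])
  also have "\<dots> \<le> real n\<^sub>0 powr real depth"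
    using n\<^sub>0 unfolding depth_def by (intro powr_mono) linarith+
  finally have "real n powr (1 - \<epsilon> / 2) \<le> real n\<^sub>0 ^ depth"
    using n\<^sub>0 by (simp add: powr_realpow)
  then have "real n / real n\<^sub>0 ^ depth \<le> real n / real n powr (1 - \<epsilon> / 2)"
    using n n\<^sub>0 by (intro divide_left_mono) auto
  also have "\<dots> = real n powr (\<epsilon> / 2)"
    using n by (simp add: powr_diff)
  finally have "real n / real n\<^sub>0 ^ depth \<le> real n powr (\<epsilon> / 2)" .
  moreover have "real n / real n\<^sub>0 ^ depth \<ge> 0" by simp
  ultimately have "real block \<le> real n powr (\<epsilon> / 2) + 1"
    unfolding block_def by linarith
  moreover have "real n powr (\<epsilon> / 2) \<ge> 1"
    using n \<epsilon> by (simp add: ge_one_powr_ge_zero)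
  ultimately show ?thesis by linarith
qed

text \<open>Rounding up the depth costs at most one extra level, hence the factor
  \<open>n\<^sub>0 powr \<omega>\<close>. At depth \<open>0\<close> there is a single machine,
  covered by the maximum with \<open>1\<close>.\<close>

lemma power_depth_le:
  assumes l: "l \<ge> 1" "real l \<le> real n\<^sub>0 powr \<omega>"
  shows "real (l ^ depth) \<le> real n\<^sub>0 powr \<omega> * max 1 (real n powr (\<omega> * (2 - \<epsilon>) / 2))"
proof (cases "depth = 0")
  case True
  have "1 * 1 \<le> real n\<^sub>0 powr \<omega> * max 1 (real n powr (\<omega> * (2 - \<epsilon>) / 2))"
    using l by (intro mult_mono) auto
  then show ?thesis using True by simp
next
  case False
  \<comment> \<open>A negative exponent would force \<open>l < 1\<close>.\<close>
  have \<omega>: "\<omega> \<ge> 0"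
  proof (rule ccontr)
    assume "\<not> \<omega> \<ge> 0"
    then have "real n\<^sub>0 powr \<omega> < real n\<^sub>0 powr 0" using n\<^sub>0 by (intro powr_less_mono) auto
    then show False using l n\<^sub>0 by simp
  qed
  have "real depth \<le> (1 - \<epsilon> / 2) * log (real n\<^sub>0) (real n) + 1"
    using False unfolding depth_def by linarith
  then have "\<omega> * real depth \<le> \<omega> * (2 - \<epsilon>) / 2 * log (real n\<^sub>0) (real n) + \<omega>"
    using mult_left_mono[OF _ \<omega>] by (fastforce simp: field_simps)
  then have "real n\<^sub>0 powr (\<omega> * real depth)
    \<le> real n\<^sub>0 powr (\<omega> * (2 - \<epsilon>) / 2 * log (real n\<^sub>0) (real n) + \<omega>)"
    using n\<^sub>0 by (intro powr_mono) auto
  also have "\<dots> = real n powr (\<omega> * (2 - \<epsilon>) / 2) * real n\<^sub>0 powr \<omega>"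
    by (simp only: powr_add powr_mult_log)
  finally have le: "real n\<^sub>0 powr (\<omega> * real depth) \<le> real n\<^sub>0 powr \<omega> * real n powr (\<omega> * (2 - \<epsilon>) / 2)"
    by (simp add: mult.commute)
  have "real (l ^ depth) \<le> (real n\<^sub>0 powr \<omega>) ^ depth"
    using l by (simp add: power_mono)
  also have "\<dots> = real n\<^sub>0 powr (\<omega> * real depth)"
    using n\<^sub>0 by (simp add: powr_powr powr_realpow[symmetric])
  also note le
  also have "real n\<^sub>0 powr \<omega> * real n powr (\<omega> * (2 - \<epsilon>) / 2)
    \<le> real n\<^sub>0 powr \<omega> * max 1 (real n powr (\<omega> * (2 - \<epsilon>) / 2))"
    by (intro mult_left_mono) auto
  finally show ?thesis .
qed

end

section \<open>The family of programs and its asymptotic bounds\<close>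

theorem theorem4p4:
  fixes x \<omega> \<epsilon> :: real
    and n\<^sub>0 l :: nat
    and \<alpha> \<beta> :: "nat \<Rightarrow> nat \<times> nat \<Rightarrow> 'a::field"
    and \<gamma> :: "nat \<times> nat \<Rightarrow> nat \<Rightarrow> 'a"
  assumes "0 < x" and "x < 1"
    and "n\<^sub>0 \<ge> 2"
    and "nc_bilinear_algorithm n\<^sub>0 (inner_dim x n\<^sub>0) n\<^sub>0 l \<alpha> \<beta> \<gamma>"
    and "real l \<le> real n\<^sub>0 powr \<omega>"
    and "\<epsilon> \<ge> 0"
  shows "\<exists>(p :: nat \<Rightarrow> nat) (s :: nat \<Rightarrow> nat) (T :: nat \<Rightarrow> nat) (\<pi> :: nat \<Rightarrow> 'a program).
    mr_matrix_mult x p s T \<pi> \<and>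
    (\<lambda>n. real (p n)) \<in> O(\<lambda>n. max 1 (real n powr (\<omega> * (2 - \<epsilon>) / 2))) \<and>
    (\<lambda>n. real (s n)) \<in> O(\<lambda>n. real n powr \<epsilon>) \<and>
    (\<lambda>n. real (T n)) \<in> O(\<lambda>n. ln (real n))"
proof -
  let ?L = "depth \<epsilon> n\<^sub>0" and ?d = "block \<epsilon> n\<^sub>0"
  have dim_le: "inner_dim x n \<le> n" if "n \<ge> 1" for n
    using powr_mono[of x 1 "real n"] that assms by (intro inner_dim_le) auto
  have m: "0 < inner_dim x n\<^sub>0" "inner_dim x n\<^sub>0 \<le> n\<^sub>0"
    using inner_dim_pos[of n\<^sub>0 x] dim_le[of n\<^sub>0] assms by auto
  have l: "l \<ge> 1"
    using nc_bilinear_algorithm_rank[OF assms(4) m(1)] assms(3) by (cases l) auto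
  have "\<exists>\<pi> :: 'a program. (\<forall>t i. local_computation (\<pi> t i)) \<and> (n \<ge> 1 \<longrightarrow>
    (\<forall>A \<in> carrier_mat n (inner_dim x n). \<forall>B \<in> carrier_mat (inner_dim x n) n.
      mr_computes (l ^ ?L n) (2 * l * (?d n)\<^sup>2) (n + 3) (2 * ?L n + 3) \<pi>
        (mat_pairs 0 A \<union> mat_pairs 1 B) (mat_pairs 2 (A * B))))" for n
  proof (cases "n \<ge> 1")
    case True
    then show ?thesis
      using mr_program_exists[OF assms(4) m le_power_block inner_dim_le_power_block dim_le block_le]
        assms by blast
  next
    \<comment> \<open>Programs must be local computations even for \<open>n = 0\<close>; a silent
      one will do.\<close>
    case False
    then show ?thesis
      by (intro exI[of _ "\<lambda>_ _. emit (\<lambda>_ _. [])"]) (auto intro: local_computation_emit)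
  qed
  then obtain \<pi> :: "nat \<Rightarrow> 'a program" where \<pi>: "\<And>n t i. local_computation (\<pi> n t i)"
    "\<And>n A B. n \<ge> 1 \<Longrightarrow> A \<in> carrier_mat n (inner_dim x n) \<Longrightarrow> B \<in> carrier_mat (inner_dim x n) n \<Longrightarrow>
      mr_computes (l ^ ?L n) (2 * l * (?d n)\<^sup>2) (n + 3) (2 * ?L n + 3) (\<pi> n)
        (mat_pairs 0 A \<union> mat_pairs 1 B) (mat_pairs 2 (A * B))"
    by metis
  have b: "(\<lambda>n. real (n + 3)) \<in> O(\<lambda>n. real n ^ 1)"
    by (rule landau_o.bigI[of 4]) (auto simp: eventually_sequentially intro!: exI[of _ 1])
  have p: "(\<lambda>n. real (l ^ ?L n)) \<in> O(\<lambda>n. max 1 (real n powr (\<omega> * (2 - \<epsilon>) / 2)))"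
  proof (rule bigoI)
    show "\<forall>\<^sub>F n in at_top. norm (real (l ^ ?L n))
      \<le> real n\<^sub>0 powr \<omega> * norm (max 1 (real n powr (\<omega> * (2 - \<epsilon>) / 2)))"
      using eventually_ge_at_top[of 1]
    proof eventually_elim
      case (elim n)
      then show ?case
        using power_depth_le[OF assms(1-3,6) elim l assms(5)] by simp
    qed
  qed
  have s: "(\<lambda>n. real (2 * l * (?d n)\<^sup>2)) \<in> O(\<lambda>n. real n powr \<epsilon>)"
  proof (rule bigoI)
    show "\<forall>\<^sub>F n in at_top. norm (real (2 * l * (?d n)\<^sup>2)) \<le> real (8 * l) * norm (real n powr \<epsilon>)"
      using eventually_ge_at_top[of 1]
    proof eventually_elim
      case (elim n)
      have "(real (?d n))\<^sup>2 \<le> (2 * real n powr (\<epsilon> / 2))\<^sup>2"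
        using block_le_powr[OF assms(1-3,6) elim] by (intro power_mono) auto
      also have "\<dots> = 4 * real n powr \<epsilon>"
        by (simp add: power2_eq_square powr_add[symmetric])
      finally show ?case using mult_left_mono[of _ _ "2 * real l"] by fastforce
    qed
  qed
  have T: "(\<lambda>n. real (2 * ?L n + 3)) \<in> O(\<lambda>n. ln (real n))"
  proof (rule bigoI)
    \<comment> \<open>Doubling \<open>ln n / ln n\<^sub>0 + 1\<close> and adding \<open>3\<close>
      leaves the constant \<open>5\<close>, at most \<open>5 * ln n\<close> once
      \<open>n \<ge> 3\<close>, since \<open>exp 1 \<le> 3\<close>.\<close>
    show "\<forall>\<^sub>F n in at_top. norm (real (2 * ?L n + 3)) \<le> (2 / ln (real n\<^sub>0) + 5) * norm (ln (real n))"
      using eventually_ge_at_top[of 3]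
    proof eventually_elim
      case (elim n)
      have "exp 1 \<le> real n" using exp_le elim by linarith
      then have "ln (real n) \<ge> 1" using elim by (subst ln_ge_iff) auto
      moreover have "real (?L n) \<le> ln (real n) / ln (real n\<^sub>0) + 1"
        using depth_le[OF assms(1-3,6), of n] elim by (simp add: log_def)
      ultimately show ?case by (simp add: algebra_simps)
    qed
  qed
  show ?thesis
    using \<pi> b p s T unfolding mr_matrix_mult_def
    by (intro exI[of _ "\<lambda>n. l ^ ?L n"] exI[of _ "\<lambda>n. 2 * l * (?d n)\<^sup>2"] exI[of _ "\<lambda>n. 2 * ?L n + 3"]
        exI[of _ \<pi>] conjI exI[of _ "\<lambda>n. n + 3"] exI[of _ 1]) auto
qed

end
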